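(* There is a computable coloring $c:\mathcal{P}_{fin}(\mathbb{N})\rightarrow\{0,1\}$ such that for every computably enumerable $\mathcal{S}\subseteq\mathcal{P}_{fin}(\mathbb{N})$ which contains infinitely many pairwise disjoint elements, $c$ is not constant on $NU(\mathcal{S})$.
   Context: $\mathcal{P}_{fin}(\mathbb{N})$ is the set of finite subsets of $\mathbb{N}$, identified with $\mathbb{N}$ via a fixed computable bijection (e.g. a finite set corresponds to the number whose binary expansion has 1s exactly at its elements); computability and computable enumerability of subsets of and functions on $\mathcal{P}_{fin}(\mathbb{N})$ are with respect to this identification. For $\mathcal{S}\subseteq\mathcal{P}_{fin}(\mathbb{N})$, $NU(\mathcal{S})$ denotes the set of non-empty sets which are unions of finitely many elements of $\mathcal{S}$. *)

theory Defs
  imports Main "HOL-Library.Nat_Bijection"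
begin

text \<open>A function of arity n is only ever
evaluated on argument lists of length n.\<close>

inductive recfn :: "nat \<Rightarrow> (nat list \<Rightarrow> nat) \<Rightarrow> bool" where
  rf_zero: "recfn n (\<lambda>_. 0)"
| rf_succ: "recfn 1 (\<lambda>xs. Suc (hd xs))"
| rf_proj: "i < n \<Longrightarrow> recfn n (\<lambda>xs. xs ! i)"
| rf_comp: "recfn m g \<Longrightarrow> length fs = m \<Longrightarrow> (\<forall>f \<in> set fs. recfn n f) \<Longrightarrow>
            recfn n (\<lambda>xs. g (map (\<lambda>f. f xs) fs))"
| rf_prim: "recfn n g \<Longrightarrow> recfn (Suc (Suc n)) h \<Longrightarrow>
            recfn (Suc n) (\<lambda>xs. rec_nat (g (tl xs)) (\<lambda>k r. h (k # r # tl xs)) (hd xs))"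
| rf_mu: "recfn (Suc n) g \<Longrightarrow> (\<forall>xs. length xs = n \<longrightarrow> (\<exists>y. g (y # xs) = 0)) \<Longrightarrow>
          recfn n (\<lambda>xs. LEAST y. g (y # xs) = 0)"

definition computable :: "(nat \<Rightarrow> nat) \<Rightarrow> bool" where
  "computable f \<longleftrightarrow> (\<exists>g. recfn 1 g \<and> (\<forall>x. f x = g [x]))"

definition ce :: "nat set \<Rightarrow> bool" where
  "ce A \<longleftrightarrow> (\<exists>g. recfn 2 g \<and> A = {x. \<exists>y. g [x, y] = 0})"

text \<open>Finite subsets of N are coded by naturals via binary expansion:
set_encode / set_decode from Nat_Bijection.  NU(S): nonempty finite unions.\<close>
definition NU :: "nat set set \<Rightarrow> nat set set" where
  "NU S = {A. A \<noteq> {} \<and> (\<exists>F. finite F \<and> F \<subseteq> S \<and> A = \<Union>F)}"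

end

theory Submission
  imports Defs
begin

text \<open>
  The colouring is built by a diagonalisation, with approximations in the limit, against all
  computably enumerable families of finite sets.  Let \<open>W\<^sub>e\<close> be the \<open>e\<close>-th c.e. set
  of codes and \<open>H\<^sub>e\<close> the union of the sets \<open>F\<^sub>0, \<dots>, F\<^sub>e\<^sub>-\<^sub>1\<close> chosen for earlier
  requirements; \<open>F\<^sub>e\<close> is the least nonempty member of \<open>W\<^sub>e\<close> disjoint from \<open>H\<^sub>e\<close> (if any).
  At stage \<open>z\<close> (the code of a finite set \<open>Z\<close>) all of this is approximated with
  search bound \<open>z\<close>; if some requirement \<open>e < z\<close> has found a nonempty proper subset
  \<open>F \<subset> Z\<close>, the least such \<open>e\<close> makes the colour of \<open>Z\<close> differ from that of \<open>Z - F\<close>.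
  If \<open>W\<^sub>e\<close> contains infinitely many disjoint sets, then \<open>F\<^sub>e\<close> exists, and for a member
  \<open>Y\<close> of the family with large code and disjoint from \<open>H\<^sub>e\<^sub>+\<^sub>1\<close>, the set \<open>Z = F\<^sub>e \<union> Y\<close>
  gets a colour different from \<open>Y\<close>; both lie in \<open>NU(W\<^sub>e)\<close>.
\<close>

section \<open>Functions agreeing with recursive functions\<close>

text \<open>\<open>recfn\<close> is intensional and only meaningful on argument lists of the right
  length, so we work with functions that agree with some recursive function there.\<close>

definition rec_fun :: "nat \<Rightarrow> (nat list \<Rightarrow> nat) \<Rightarrow> bool" where
  "rec_fun n f \<longleftrightarrow> (\<exists>g. recfn n g \<and> (\<forall>xs. length xs = n \<longrightarrow> f xs = g xs))"

lemma rec_fun_cong: "rec_fun n f \<Longrightarrow> (\<And>xs. length xs = n \<Longrightarrow> f xs = g xs) \<Longrightarrow> rec_fun n g"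
  unfolding rec_fun_def by metis

lemma recfn_rec_fun: "recfn n f \<Longrightarrow> rec_fun n f"
  unfolding rec_fun_def by blast

lemma rec_fun_zero: "rec_fun n (\<lambda>_. 0)"
  by (rule recfn_rec_fun, rule recfn.rf_zero)

lemma rec_fun_succ: "rec_fun 1 (\<lambda>xs. Suc (hd xs))"
  by (rule recfn_rec_fun, rule recfn.rf_succ)

lemma rec_fun_proj: "i < n \<Longrightarrow> rec_fun n (\<lambda>xs. xs ! i)"
  by (rule recfn_rec_fun, rule recfn.rf_proj)

lemma rec_fun_comp:
  assumes g: "rec_fun m g" and len: "length fs = m" and fs: "\<forall>f\<in>set fs. rec_fun n f"
  shows "rec_fun n (\<lambda>xs. g (map (\<lambda>f. f xs) fs))"
proof -
  from g obtain g' where g': "recfn m g'" "\<forall>xs. length xs = m \<longrightarrow> g xs = g' xs"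
    unfolding rec_fun_def by blast
  from fs have "\<forall>f\<in>set fs. \<exists>h. recfn n h \<and> (\<forall>xs. length xs = n \<longrightarrow> f xs = h xs)"
    unfolding rec_fun_def by blast
  then obtain R where R: "\<forall>f\<in>set fs. recfn n (R f) \<and> (\<forall>xs. length xs = n \<longrightarrow> f xs = R f xs)"
    by metis
  have "recfn n (\<lambda>xs. g' (map (\<lambda>f. f xs) (map R fs)))"
    by (rule recfn.rf_comp[OF g'(1)]) (use len R in auto)
  moreover have "g (map (\<lambda>f. f xs) fs) = g' (map (\<lambda>f. f xs) (map R fs))" if "length xs = n" for xs
  proof -
    have "map (\<lambda>f. f xs) fs = map (\<lambda>f. f xs) (map R fs)"
      unfolding map_map comp_def using R that by (auto intro!: map_cong)
    moreover have "g (map (\<lambda>f. f xs) fs) = g' (map (\<lambda>f. f xs) fs)"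
      using g'(2) len by simp
    ultimately show ?thesis by metis
  qed
  ultimately show ?thesis unfolding rec_fun_def by blast
qed

lemma rec_fun_prim:
  assumes g: "rec_fun n g" and h: "rec_fun (Suc (Suc n)) h"
  shows "rec_fun (Suc n) (\<lambda>xs. rec_nat (g (tl xs)) (\<lambda>k r. h (k # r # tl xs)) (hd xs))"
proof -
  from g obtain g' where g': "recfn n g'" "\<forall>xs. length xs = n \<longrightarrow> g xs = g' xs"
    unfolding rec_fun_def by blast
  from h obtain h' where h': "recfn (Suc (Suc n)) h'" "\<forall>xs. length xs = Suc (Suc n) \<longrightarrow> h xs = h' xs"
    unfolding rec_fun_def by blast
  have "recfn (Suc n) (\<lambda>xs. rec_nat (g' (tl xs)) (\<lambda>k r. h' (k # r # tl xs)) (hd xs))"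
    by (rule recfn.rf_prim[OF g'(1) h'(1)])
  moreover have "rec_nat (g (tl xs)) (\<lambda>k r. h (k # r # tl xs)) (hd xs)
      = rec_nat (g' (tl xs)) (\<lambda>k r. h' (k # r # tl xs)) (hd xs)" if "length xs = Suc n" for xs
    using g'(2) h'(2) that by simp
  ultimately show ?thesis unfolding rec_fun_def by blast
qed

lemma rec_fun_mu:
  assumes g: "rec_fun (Suc n) g" and tot: "\<forall>xs. length xs = n \<longrightarrow> (\<exists>y. g (y # xs) = 0)"
  shows "rec_fun n (\<lambda>xs. LEAST y. g (y # xs) = 0)"
proof -
  from g obtain g' where g': "recfn (Suc n) g'" "\<forall>xs. length xs = Suc n \<longrightarrow> g xs = g' xs"
    unfolding rec_fun_def by blast
  have "recfn n (\<lambda>xs. LEAST y. g' (y # xs) = 0)"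
    by (rule recfn.rf_mu[OF g'(1)]) (use tot g'(2) in auto)
  moreover have "(LEAST y. g (y # xs) = 0) = (LEAST y. g' (y # xs) = 0)" if "length xs = n" for xs
    using g'(2) that by simp
  ultimately show ?thesis unfolding rec_fun_def by blast
qed

lemma rec_fun_comp1: "rec_fun 1 g \<Longrightarrow> rec_fun n f \<Longrightarrow> rec_fun n (\<lambda>xs. g [f xs])"
  using rec_fun_comp[of 1 g "[f]" n] by simp

lemma rec_fun_comp2: "rec_fun 2 g \<Longrightarrow> rec_fun n f1 \<Longrightarrow> rec_fun n f2 \<Longrightarrow> rec_fun n (\<lambda>xs. g [f1 xs, f2 xs])"
  using rec_fun_comp[of 2 g "[f1, f2]" n] by simp

lemma rec_fun_Suc: "rec_fun n f \<Longrightarrow> rec_fun n (\<lambda>xs. Suc (f xs))"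
  using rec_fun_comp1[OF rec_fun_succ] by simp

lemma rec_fun_const: "rec_fun n (\<lambda>_. c)"
  by (induction c) (auto intro: rec_fun_zero dest: rec_fun_Suc)

lemma rec_fun_prim2:
  assumes g: "rec_fun 1 (\<lambda>xs. g (xs!0))" and h: "rec_fun 3 (\<lambda>xs. h (xs!0) (xs!1) (xs!2))"
  shows "rec_fun 2 (\<lambda>xs. rec_nat (g (xs!1)) (\<lambda>k r. h k r (xs!1)) (xs!0))"
proof -
  have "rec_fun (Suc 1) (\<lambda>xs. rec_nat ((\<lambda>xs. g (xs!0)) (tl xs))
      (\<lambda>k r. (\<lambda>xs. h (xs!0) (xs!1) (xs!2)) (k # r # tl xs)) (hd xs))"
    by (rule rec_fun_prim[OF g]) (use h in \<open>simp add: numeral_3_eq_3\<close>)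
  then have "rec_fun 2 (\<lambda>xs. rec_nat (g (tl xs ! 0)) (\<lambda>k r. h k r (tl xs ! 0)) (hd xs))"
    by (simp add: numeral_2_eq_2)
  then show ?thesis
    by (rule rec_fun_cong) (auto simp: length_Suc_conv numeral_2_eq_2)
qed

section \<open>Computable unary functions and decidable predicates\<close>

text \<open>Multi-argument computations are reduced to unary ones via Cantor pairing, so the
  frozen notion \<open>computable\<close> is the central one; we characterise it by \<open>rec_fun\<close>.\<close>

lemma computable_iff_rec_fun: "computable f \<longleftrightarrow> rec_fun 1 (\<lambda>xs. f (hd xs))"
proof
  assume "computable f"
  then obtain g where g: "recfn 1 g" "\<forall>x. f x = g [x]" unfolding computable_def by blast
  have "f (hd xs) = g xs" if "length xs = 1" for xs :: "nat list"
    using that g(2) by (cases xs) auto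
  with g(1) show "rec_fun 1 (\<lambda>xs. f (hd xs))" unfolding rec_fun_def by blast
next
  assume "rec_fun 1 (\<lambda>xs. f (hd xs))"
  then obtain g where g: "recfn 1 g" "\<forall>xs. length xs = 1 \<longrightarrow> f (hd xs) = g xs"
    unfolding rec_fun_def by blast
  have "f x = g [x]" for x using g(2)[rule_format, of "[x]"] by simp
  with g(1) show "computable f" unfolding computable_def by blast
qed

definition decidable :: "(nat \<Rightarrow> bool) \<Rightarrow> bool" where
  "decidable P \<longleftrightarrow> computable (\<lambda>x. if P x then 1 else 0)"

definition computable2 :: "(nat \<Rightarrow> nat \<Rightarrow> nat) \<Rightarrow> bool" where
  "computable2 h \<longleftrightarrow> rec_fun 2 (\<lambda>xs. h (xs!0) (xs!1))"

lemma rec_fun_app1: "computable f \<Longrightarrow> rec_fun n F \<Longrightarrow> rec_fun n (\<lambda>xs. f (F xs))"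
  unfolding computable_iff_rec_fun using rec_fun_comp1[of "\<lambda>xs. f (hd xs)" n F] by simp

lemma rec_fun_app2:
  "computable2 h \<Longrightarrow> rec_fun n F \<Longrightarrow> rec_fun n G \<Longrightarrow> rec_fun n (\<lambda>xs. h (F xs) (G xs))"
  unfolding computable2_def using rec_fun_comp2[of "\<lambda>xs. h (xs!0) (xs!1)" n F G] by simp

lemma computable_rec_fun1: "computable f \<Longrightarrow> rec_fun 1 (\<lambda>xs. f (xs!0))"
  unfolding computable_iff_rec_fun by (erule rec_fun_cong) (auto simp: length_Suc_conv)

lemma computable_id: "computable (\<lambda>x. x)"
proof -
  have "rec_fun 1 hd"
    by (rule rec_fun_cong[OF rec_fun_proj[of 0 1]]) (auto simp: length_Suc_conv)
  then show ?thesis unfolding computable_iff_rec_fun by simp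
qed

lemma computable_const: "computable (\<lambda>x. c)"
  unfolding computable_iff_rec_fun by (rule rec_fun_const)

lemma computable_app2:
  "computable2 h \<Longrightarrow> computable f \<Longrightarrow> computable g \<Longrightarrow> computable (\<lambda>x. h (f x) (g x))"
  unfolding computable_iff_rec_fun by (rule rec_fun_app2)

lemma computable_comp: "computable f \<Longrightarrow> computable g \<Longrightarrow> computable (\<lambda>x. f (g x))"
  unfolding computable_iff_rec_fun by (rule rec_fun_app1[unfolded computable_iff_rec_fun])

lemma computable_Suc: "computable f \<Longrightarrow> computable (\<lambda>x. Suc (f x))"
  unfolding computable_iff_rec_fun by (rule rec_fun_Suc)

lemma computable_eqI: "computable f \<Longrightarrow> (\<And>x. f x = g x) \<Longrightarrow> computable g"
proof -
  assume "computable f" "\<And>x. f x = g x"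
  then have "f = g" by (simp add: ext)
  with \<open>computable f\<close> show ?thesis by simp
qed

lemma rec_nat_add: "rec_nat b (\<lambda>k r. Suc r) a = a + b"
  by (induction a) auto

lemma computable2_add: "computable2 (+)"
proof -
  have "rec_fun 2 (\<lambda>xs. rec_nat ((\<lambda>x. x) (xs!1)) (\<lambda>k r. (\<lambda>k r p. Suc r) k r (xs!1)) (xs!0))"
    by (rule rec_fun_prim2) (intro rec_fun_Suc rec_fun_proj | simp)+
  then show ?thesis unfolding computable2_def by (rule rec_fun_cong) (simp add: rec_nat_add)
qed

lemma rec_nat_pred: "rec_nat 0 (\<lambda>k r. k) a = a - 1"
  by (cases a) auto

lemma computable_pred: "computable (\<lambda>x. x - 1)"
proof -
  have "rec_fun (Suc 0) (\<lambda>xs. rec_nat ((\<lambda>_. 0) (tl xs)) (\<lambda>k r. (\<lambda>xs. xs!0) (k # r # tl xs)) (hd xs))"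
    by (rule rec_fun_prim) (intro rec_fun_zero rec_fun_proj | simp)+
  then have "rec_fun 1 (\<lambda>xs. rec_nat 0 (\<lambda>k r. k) (hd xs))" by simp
  then show ?thesis unfolding computable_iff_rec_fun by (rule rec_fun_cong) (simp add: rec_nat_pred)
qed

lemma rec_nat_sub: "rec_nat b (\<lambda>k r. r - 1) a = b - a"
  by (induction a) auto

lemma computable2_sub: "computable2 (-)"
proof -
  have "rec_fun 2 (\<lambda>xs. rec_nat ((\<lambda>x. x) (xs!1)) (\<lambda>k r. (\<lambda>k r p. r - 1) k r (xs!1)) (xs!0))"
    by (rule rec_fun_prim2) (intro rec_fun_app1[OF computable_pred] rec_fun_proj | simp)+
  then have "rec_fun 2 (\<lambda>xs. xs!1 - xs!0)" by (rule rec_fun_cong) (simp add: rec_nat_sub[simplified])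
  then have "rec_fun 2 (\<lambda>xs. (\<lambda>xs. xs!1 - xs!0) [xs!1, xs!0])"
    by (intro rec_fun_comp2) (auto intro: rec_fun_proj)
  then show ?thesis unfolding computable2_def by simp
qed

lemma rec_nat_mult: "rec_nat 0 (\<lambda>k r. r + b) a = a * b"
  by (induction a) auto

lemma computable2_mult: "computable2 (*)"
proof -
  have "rec_fun 2 (\<lambda>xs. rec_nat ((\<lambda>x. 0) (xs!1)) (\<lambda>k r. (\<lambda>k r p. r + p) k r (xs!1)) (xs!0))"
    by (rule rec_fun_prim2) (intro rec_fun_zero rec_fun_app2[OF computable2_add] rec_fun_proj | simp)+
  then show ?thesis unfolding computable2_def by (rule rec_fun_cong) (simp add: rec_nat_mult)
qed

lemma computable_add: "computable f \<Longrightarrow> computable g \<Longrightarrow> computable (\<lambda>x. f x + g x)"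
  by (rule computable_app2[OF computable2_add])

lemma computable_sub: "computable f \<Longrightarrow> computable g \<Longrightarrow> computable (\<lambda>x. f x - g x)"
  by (rule computable_app2[OF computable2_sub])

lemma computable_mult: "computable f \<Longrightarrow> computable g \<Longrightarrow> computable (\<lambda>x. f x * g x)"
  by (rule computable_app2[OF computable2_mult])

lemma rec_nat_triangle: "rec_nat 0 (\<lambda>k r. r + Suc k) n = triangle n"
  by (induction n) auto

lemma computable_triangle: "computable triangle"
proof -
  have "rec_fun (Suc 0) (\<lambda>xs. rec_nat ((\<lambda>_. 0) (tl xs))
      (\<lambda>k r. (\<lambda>xs. xs!1 + Suc (xs!0)) (k # r # tl xs)) (hd xs))"
    by (rule rec_fun_prim)
      (intro rec_fun_zero rec_fun_app2[OF computable2_add] rec_fun_proj rec_fun_Suc | simp)+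
  then have "rec_fun 1 (\<lambda>xs. rec_nat 0 (\<lambda>k r. r + Suc k) (hd xs))" by simp
  then show ?thesis unfolding computable_iff_rec_fun
    by (rule rec_fun_cong) (simp add: rec_nat_triangle[simplified])
qed

definition pe :: "nat \<Rightarrow> nat \<Rightarrow> nat" where "pe a b = prod_encode (a, b)"
definition pfst :: "nat \<Rightarrow> nat" where "pfst z = fst (prod_decode z)"
definition psnd :: "nat \<Rightarrow> nat" where "psnd z = snd (prod_decode z)"

lemma pfst_pe [simp]: "pfst (pe a b) = a" by (simp add: pfst_def pe_def)
lemma psnd_pe [simp]: "psnd (pe a b) = b" by (simp add: psnd_def pe_def)
lemma pe_split [simp]: "pe (pfst z) (psnd z) = z" by (simp add: pfst_def psnd_def pe_def)
lemma pe_eq [simp]: "pe a b = pe c d \<longleftrightarrow> a = c \<and> b = d" by (simp add: pe_def)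
lemma pe_ge2: "b \<le> pe a b" by (simp add: pe_def le_prod_encode_2)

lemma computable2_pe: "computable2 pe"
proof -
  have "rec_fun 2 (\<lambda>xs. triangle (xs!0 + xs!1) + xs!0)"
    by (intro rec_fun_app2[OF computable2_add] rec_fun_app1[OF computable_triangle] rec_fun_proj | simp)+
  then show ?thesis unfolding computable2_def by (rule rec_fun_cong) (simp add: pe_def prod_encode_def)
qed

lemma rec_fun_pe: "rec_fun n F \<Longrightarrow> rec_fun n G \<Longrightarrow> rec_fun n (\<lambda>xs. pe (F xs) (G xs))"
  by (rule rec_fun_app2[OF computable2_pe])

text \<open>Unpairing: the diagonal \<open>pfst z + psnd z\<close> of \<open>z\<close> is found by unbounded search for the
  first triangular number exceeding \<open>z\<close>.\<close>

lemma triangle_mono: "s \<le> t \<Longrightarrow> triangle s \<le> triangle t"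
  by (induction t) (auto simp: le_Suc_eq)

lemma diagonal_as_least: "(LEAST s. Suc z - triangle (Suc s) = 0) = pfst z + psnd z"
proof -
  obtain a b where ab: "z = pe a b" by (metis pe_split)
  have z: "z = triangle (a + b) + a" using ab by (simp add: pe_def prod_encode_def)
  show ?thesis
  proof (rule Least_equality)
    show "Suc z - triangle (Suc (pfst z + psnd z)) = 0" using ab z by simp
  next
    fix s assume "Suc z - triangle (Suc s) = 0"
    then have "Suc z \<le> triangle (Suc s)" by simp
    show "pfst z + psnd z \<le> s"
    proof (rule ccontr)
      assume "\<not> ?thesis"
      then have "triangle (Suc s) \<le> triangle (a + b)" using ab by (intro triangle_mono) simp
      with \<open>Suc z \<le> triangle (Suc s)\<close> z show False by simp
    qed
  qed
qed

lemma computable_diagonal: "computable (\<lambda>z. pfst z + psnd z)"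
proof -
  have "rec_fun (Suc 1) (\<lambda>xs. Suc (xs!1) - triangle (Suc (xs!0)))"
    by (intro rec_fun_app2[OF computable2_sub] rec_fun_Suc
        rec_fun_app1[OF computable_triangle] rec_fun_proj | simp)+
  then have "rec_fun 1 (\<lambda>xs. LEAST s. (\<lambda>xs. Suc (xs!1) - triangle (Suc (xs!0))) (s # xs) = 0)"
  proof (rule rec_fun_mu, intro allI impI)
    fix xs :: "nat list"
    show "\<exists>s. (\<lambda>xs. Suc (xs!1) - triangle (Suc (xs!0))) (s # xs) = 0"
      by (rule exI[of _ "xs!0"]) simp
  qed
  then have "rec_fun 1 (\<lambda>xs. LEAST s. Suc (hd xs) - triangle (Suc s) = 0)"
    by (rule rec_fun_cong) (auto simp: length_Suc_conv)
  then show ?thesis unfolding computable_iff_rec_fun diagonal_as_least .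
qed

lemma computable_pfst0: "computable pfst"
proof -
  have "computable (\<lambda>z. z - triangle (pfst z + psnd z))"
    by (intro computable_sub computable_id computable_comp[OF computable_triangle computable_diagonal])
  then show ?thesis
  proof (rule computable_eqI)
    fix z
    obtain a b where z: "z = pe a b" by (metis pe_split)
    then have "z = triangle (a + b) + a" by (simp add: pe_def prod_encode_def)
    with z show "z - triangle (pfst z + psnd z) = pfst z" by simp
  qed
qed

lemma computable_psnd0: "computable psnd"
proof -
  have "computable (\<lambda>z. (pfst z + psnd z) - pfst z)"
    by (intro computable_sub computable_diagonal computable_pfst0)
  then show ?thesis by simp
qed

lemma computable_pe: "computable f \<Longrightarrow> computable g \<Longrightarrow> computable (\<lambda>x. pe (f x) (g x))"
  by (rule computable_app2[OF computable2_pe])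

lemma computable_pfst: "computable f \<Longrightarrow> computable (\<lambda>x. pfst (f x))"
  by (rule computable_comp[OF computable_pfst0])

lemma computable_psnd: "computable f \<Longrightarrow> computable (\<lambda>x. psnd (f x))"
  by (rule computable_comp[OF computable_psnd0])

text \<open>Primitive recursion whose step function may use the parameter \<open>x\<close>; the step function
  is given as a computable function of a nested pair \<open>(i, (r, x))\<close>.\<close>

lemma computable_rec:
  assumes b: "computable b" and s: "computable (\<lambda>z. s (pfst z) (pfst (psnd z)) (psnd (psnd z)))"
    and K: "computable K"
  shows "computable (\<lambda>x. rec_nat (b x) (\<lambda>i r. s i r x) (K x))"
proof -
  have "rec_fun 3 (\<lambda>xs. (\<lambda>z. s (pfst z) (pfst (psnd z)) (psnd (psnd z))) (pe (xs!0) (pe (xs!1) (xs!2))))"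
    by (rule rec_fun_app1[OF s]) (intro rec_fun_pe rec_fun_proj; simp)
  then have "rec_fun 3 (\<lambda>xs. s (xs!0) (xs!1) (xs!2))" by simp
  then have "rec_fun 2 (\<lambda>xs. rec_nat (b (xs!1)) (\<lambda>k r. s k r (xs!1)) (xs!0))"
    by (rule rec_fun_prim2[OF computable_rec_fun1[OF b]])
  then have "computable2 (\<lambda>k x. rec_nat (b x) (\<lambda>i r. s i r x) k)" unfolding computable2_def .
  from computable_app2[OF this K computable_id] show ?thesis .
qed

lemma computable_mu:
  assumes g: "computable (\<lambda>z. g (pfst z) (psnd z))" and tot: "\<forall>x. \<exists>y. g y x = 0"
  shows "computable (\<lambda>x. LEAST y. g y x = 0)"
proof -
  have "rec_fun 2 (\<lambda>xs. (\<lambda>z. g (pfst z) (psnd z)) (pe (xs!0) (xs!1)))"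
    by (rule rec_fun_app1[OF g]) (intro rec_fun_pe rec_fun_proj; simp)
  then have "rec_fun (Suc 1) (\<lambda>xs. g (xs!0) (xs!1))" by (simp add: numeral_2_eq_2)
  then have "rec_fun 1 (\<lambda>xs. LEAST y. (\<lambda>xs. g (xs!0) (xs!1)) (y # xs) = 0)"
    by (rule rec_fun_mu) (use tot in auto)
  then show ?thesis unfolding computable_iff_rec_fun by (rule rec_fun_cong) (auto simp: length_Suc_conv)
qed

lemma computable_funpow:
  "computable f \<Longrightarrow> computable K \<Longrightarrow> computable A \<Longrightarrow> computable (\<lambda>x. (f ^^ K x) (A x))"
proof -
  assume f: "computable f" and K: "computable K" and A: "computable A"
  have "computable (\<lambda>x. rec_nat (A x) (\<lambda>i r. f r) (K x))"
    by (rule computable_rec[OF A _ K]) (intro computable_comp[OF f] computable_pfst computable_psnd computable_id)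
  moreover have "rec_nat a (\<lambda>i r. f r) k = (f ^^ k) a" for a k
    by (induction k) auto
  ultimately show ?thesis by simp
qed

lemma rec_nat_pow2: "rec_nat 1 (\<lambda>k r. r + r) n = (2::nat) ^ n"
  by (induction n) auto

lemma computable_pow2: "computable f \<Longrightarrow> computable (\<lambda>x. 2 ^ f x)"
proof -
  assume f: "computable f"
  have "computable (\<lambda>x. rec_nat 1 (\<lambda>k r. r + r) (f x))"
    by (intro computable_rec computable_add computable_pfst computable_psnd computable_id computable_const f)
  then show ?thesis unfolding rec_nat_pow2 .
qed

text \<open>Case distinctions and logical connectives are computed arithmetically from
  0/1-valued characteristic functions.\<close>

lemma computable_if:
  "decidable P \<Longrightarrow> computable f \<Longrightarrow> computable g \<Longrightarrow> computable (\<lambda>x. if P x then f x else g x)"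
proof -
  assume P: "decidable P" and f: "computable f" and g: "computable g"
  have "computable (\<lambda>x. (if P x then 1 else 0) * f x + (1 - (if P x then 1 else 0)) * g x)"
    using P f g unfolding decidable_def by (intro computable_add computable_mult computable_sub computable_const)
  then show ?thesis by (rule computable_eqI) auto
qed

lemma decidable_eq: "computable f \<Longrightarrow> computable g \<Longrightarrow> decidable (\<lambda>x. f x = g x)"
proof -
  assume f: "computable f" and g: "computable g"
  have "computable (\<lambda>x. 1 - ((f x - g x) + (g x - f x)))"
    using f g by (intro computable_add computable_sub computable_const)
  then show ?thesis unfolding decidable_def by (rule computable_eqI) auto
qed

lemma decidable_less: "computable f \<Longrightarrow> computable g \<Longrightarrow> decidable (\<lambda>x. f x < g x)"
proof -
  assume f: "computable f" and g: "computable g"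
  have "computable (\<lambda>x. 1 - (1 - (g x - f x)))"
    using f g by (intro computable_sub computable_const)
  then show ?thesis unfolding decidable_def by (rule computable_eqI) auto
qed

lemma decidable_not: "decidable P \<Longrightarrow> decidable (\<lambda>x. \<not> P x)"
proof -
  assume P: "decidable P"
  have "computable (\<lambda>x. 1 - (if P x then 1 else 0))"
    using P unfolding decidable_def by (intro computable_sub computable_const)
  then show ?thesis unfolding decidable_def by (rule computable_eqI) auto
qed

lemma decidable_and: "decidable P \<Longrightarrow> decidable Q \<Longrightarrow> decidable (\<lambda>x. P x \<and> Q x)"
proof -
  assume P: "decidable P" and Q: "decidable Q"
  have "computable (\<lambda>x. (if P x then 1 else 0) * (if Q x then 1 else 0))"
    using P Q unfolding decidable_def by (intro computable_mult)
  then show ?thesis unfolding decidable_def by (rule computable_eqI) auto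
qed

lemma decidable_or: "decidable P \<Longrightarrow> decidable Q \<Longrightarrow> decidable (\<lambda>x. P x \<or> Q x)"
proof -
  assume "decidable P" "decidable Q"
  then have "decidable (\<lambda>x. \<not> (\<not> P x \<and> \<not> Q x))" by (intro decidable_not decidable_and)
  then show ?thesis by simp
qed

lemma decidable_imp: "decidable P \<Longrightarrow> decidable Q \<Longrightarrow> decidable (\<lambda>x. P x \<longrightarrow> Q x)"
proof -
  assume "decidable P" "decidable Q"
  then have "decidable (\<lambda>x. \<not> P x \<or> Q x)" by (intro decidable_not decidable_or)
  then show ?thesis by simp
qed

lemma decidable_if:
  "decidable P \<Longrightarrow> decidable Q \<Longrightarrow> decidable R \<Longrightarrow> decidable (\<lambda>x. if P x then Q x else R x)"
proof -
  assume "decidable P" "decidable Q" "decidable R"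
  then have "decidable (\<lambda>x. (P x \<and> Q x) \<or> (\<not> P x \<and> R x))"
    by (intro decidable_or decidable_and decidable_not)
  then show ?thesis unfolding decidable_def by (rule computable_eqI) auto
qed

lemma decidable_le: "computable f \<Longrightarrow> computable g \<Longrightarrow> decidable (\<lambda>x. f x \<le> g x)"
proof -
  assume "computable f" "computable g"
  then have "decidable (\<lambda>x. \<not> g x < f x)" by (intro decidable_not decidable_less)
  then show ?thesis by (simp add: not_less)
qed

lemma decidable_neq: "computable f \<Longrightarrow> computable g \<Longrightarrow> decidable (\<lambda>x. f x \<noteq> g x)"
  by (intro decidable_not decidable_eq)

lemma decidable_False: "decidable (\<lambda>x. False)"
  unfolding decidable_def by (simp add: computable_const)

text \<open>Bounded search: the least \<open>j\<close> below the bound \<open>B x\<close> with \<open>P j x\<close>, or \<open>B x\<close> itself.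
  Bounded quantifiers reduce to it.\<close>

lemma computable_bounded_least:
  assumes P: "decidable (\<lambda>z. P (pfst z) (psnd z))" and B: "computable B"
  shows "computable (\<lambda>x. LEAST j. j = B x \<or> P j x)"
proof -
  have "computable (\<lambda>z. if pfst z = B (psnd z) \<or> P (pfst z) (psnd z) then 0 else 1)"
    using P B by (intro computable_if decidable_or decidable_eq computable_pfst computable_id
        computable_comp[OF B] computable_psnd computable_const)
  then have "computable (\<lambda>x. LEAST y. (if y = B x \<or> P y x then 0 else 1) = (0::nat))"
    by (rule computable_mu[where g="\<lambda>y x. if y = B x \<or> P y x then 0 else 1"]) auto
  then show ?thesis by (rule computable_eqI) simp
qed

lemma ex_less_iff_least: "(\<exists>j<(B::nat). P j) \<longleftrightarrow> (LEAST j. j = B \<or> P j) < B"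
proof
  assume "\<exists>j<B. P j"
  then obtain j where "j < B" "P j" by blast
  have "(LEAST j. j = B \<or> P j) \<le> j" by (rule Least_le) (simp add: \<open>P j\<close>)
  then show "(LEAST j. j = B \<or> P j) < B" using \<open>j < B\<close> by simp
next
  assume a: "(LEAST j. j = B \<or> P j) < B"
  have "(LEAST j. j = B \<or> P j) = B \<or> P (LEAST j. j = B \<or> P j)"
    by (rule LeastI[of _ B]) simp
  with a show "\<exists>j<B. P j" by auto
qed

lemma decidable_ex_less:
  assumes P: "decidable (\<lambda>z. P (pfst z) (psnd z))" and B: "computable B"
  shows "decidable (\<lambda>x. \<exists>j<B x. P j x)"
proof -
  have "decidable (\<lambda>x. (LEAST j. j = B x \<or> P j x) < B x)"
    using P B by (intro decidable_less computable_bounded_least)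
  then show ?thesis by (simp add: ex_less_iff_least)
qed

lemma decidable_all_less:
  assumes P: "decidable (\<lambda>z. P (pfst z) (psnd z))" and B: "computable B"
  shows "decidable (\<lambda>x. \<forall>j<B x. P j x)"
proof -
  have "decidable (\<lambda>x. \<not> (\<exists>j<B x. \<not> P j x))"
    using P B by (intro decidable_not decidable_ex_less) auto
  then show ?thesis by simp
qed

lemmas computable_rules = computable_id computable_const computable_add computable_sub
  computable_mult computable_Suc computable_pe computable_pfst computable_psnd computable_if
  computable_bounded_least computable_pow2
lemmas decidable_rules = decidable_if decidable_eq decidable_less decidable_le decidable_neq
  decidable_not decidable_and decidable_or decidable_imp decidable_False
  decidable_ex_less decidable_all_less

section \<open>A universal evaluator\<close>

text \<open>Programs are natural numbers \<open>pe k p\<close>: \<open>k\<close> selects an instruction (zero, successor,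
  predecessor, the two unpairings, pairing, composition, primitive recursion, search)
  and \<open>p\<close> codes its subprograms.  \<open>Eval c n v\<close> says that program \<open>c\<close> on input \<open>n\<close>
  halts with value \<open>v\<close>.  Every recursive function has a program, and since evaluations
  have finite derivations, they can be certified by decidable finite objects below.\<close>

inductive Eval :: "nat \<Rightarrow> nat \<Rightarrow> nat \<Rightarrow> bool" where
  ev_zero: "Eval (pe 0 p) n 0"
| ev_succ: "Eval (pe 1 p) n (Suc n)"
| ev_pred: "Eval (pe 2 p) n (n - 1)"
| ev_fst: "Eval (pe 3 p) n (pfst n)"
| ev_snd: "Eval (pe 4 p) n (psnd n)"
| ev_pair: "Eval f n a \<Longrightarrow> Eval g n b \<Longrightarrow> Eval (pe 5 (pe f g)) n (pe a b)"
| ev_comp: "Eval g n a \<Longrightarrow> Eval f a b \<Longrightarrow> Eval (pe 6 (pe f g)) n b"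
| ev_prec0: "Eval f a v \<Longrightarrow> Eval (pe 7 (pe f g)) (pe a 0) v"
| ev_precS: "Eval (pe 7 (pe f g)) (pe a k) r \<Longrightarrow> Eval g (pe a (pe k r)) v \<Longrightarrow>
    Eval (pe 7 (pe f g)) (pe a (Suc k)) v"
| ev_find: "Eval f (pe n v) 0 \<Longrightarrow> (\<forall>y<v. \<exists>w. w \<noteq> 0 \<and> Eval f (pe n y) w) \<Longrightarrow> Eval (pe 8 f) n v"

lemma Eval_deterministic: "Eval c n v \<Longrightarrow> Eval c n v' \<Longrightarrow> v = v'"
proof (induction arbitrary: v' rule: Eval.induct)
  case (ev_find f n v)
  from ev_find.prems have A: "Eval f (pe n v') 0" and B: "\<forall>y<v'. \<exists>w. w \<noteq> 0 \<and> Eval f (pe n y) w"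
    by (auto elim: Eval.cases)
  show ?case
  proof (rule linorder_cases[of v v'])
    assume "v < v'"
    with B obtain w where "w \<noteq> 0" "Eval f (pe n v) w" by blast
    with ev_find.IH(1) show ?thesis by auto
  next
    assume "v' < v"
    with ev_find.IH(2) obtain w where "w \<noteq> 0" "\<forall>w'. Eval f (pe n v') w' \<longrightarrow> w = w'" by blast
    with A show ?thesis by auto
  qed
next
  case (ev_precS f g a k r v)
  from ev_precS.prems obtain r' where "Eval (pe 7 (pe f g)) (pe a k) r'" "Eval g (pe a (pe k r')) v'"
    by (cases rule: Eval.cases) auto
  with ev_precS.IH show ?case by auto
next
  case (ev_prec0 f a v g)
  from ev_prec0.prems have "Eval f a v'" by (cases rule: Eval.cases) auto
  with ev_prec0.IH show ?case by auto
next
  case (ev_comp g n a f b)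
  from ev_comp.prems obtain a' where "Eval g n a'" "Eval f a' v'" by (cases rule: Eval.cases) auto
  with ev_comp.IH show ?case by auto
next
  case (ev_pair f n a g b)
  from ev_pair.prems obtain a' b' where "Eval f n a'" "Eval g n b'" "v' = pe a' b'" by (cases rule: Eval.cases) auto
  with ev_pair.IH show ?case by auto
qed (auto elim: Eval.cases)

definition cZ :: nat where "cZ = pe 0 0"
definition cS :: nat where "cS = pe 1 0"
definition cP :: nat where "cP = pe 2 0"
definition cL :: nat where "cL = pe 3 0"
definition cR :: nat where "cR = pe 4 0"
definition cpair :: "nat \<Rightarrow> nat \<Rightarrow> nat" where "cpair f g = pe 5 (pe f g)"
definition ccomp :: "nat \<Rightarrow> nat \<Rightarrow> nat" where "ccomp f g = pe 6 (pe f g)"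
definition cprec :: "nat \<Rightarrow> nat \<Rightarrow> nat" where "cprec f g = pe 7 (pe f g)"
definition cfind :: "nat \<Rightarrow> nat" where "cfind f = pe 8 f"

lemma Eval_Z: "Eval cZ n 0" unfolding cZ_def by (rule ev_zero)
lemma Eval_S: "Eval cS n (Suc n)" unfolding cS_def by (rule ev_succ)
lemma Eval_P: "Eval cP n (n - 1)" unfolding cP_def by (rule ev_pred)
lemma Eval_L: "Eval cL n (pfst n)" unfolding cL_def by (rule ev_fst)
lemma Eval_R: "Eval cR n (psnd n)" unfolding cR_def by (rule ev_snd)
lemma Eval_pair: "Eval f n a \<Longrightarrow> Eval g n b \<Longrightarrow> Eval (cpair f g) n (pe a b)"
  unfolding cpair_def by (rule ev_pair)
lemma Eval_comp: "Eval g n a \<Longrightarrow> Eval f a b \<Longrightarrow> Eval (ccomp f g) n b"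
  unfolding ccomp_def by (rule ev_comp)

text \<open>Argument lists are passed as \<open>list_encode\<close> codes, whose nonempty case is a
  successor of a pair.\<close>

lemma list_encode_Cons: "list_encode (x # xs) = Suc (pe x (list_encode xs))"
  by (simp add: pe_def)

definition cHD :: nat where "cHD = ccomp cL cP"
definition cTL :: nat where "cTL = ccomp cR cP"
definition ccons :: "nat \<Rightarrow> nat \<Rightarrow> nat" where "ccons a b = ccomp cS (cpair a b)"
definition cID :: nat where "cID = ccomp cP cS"

lemma Eval_HD: "Eval cHD (list_encode (x # xs)) x"
  unfolding cHD_def list_encode_Cons by (rule Eval_comp[OF Eval_P]) (metis Eval_L diff_Suc_1 pfst_pe)

lemma Eval_TL: "Eval cTL (list_encode (x # xs)) (list_encode xs)"
  unfolding cTL_def list_encode_Cons by (rule Eval_comp[OF Eval_P]) (metis Eval_R diff_Suc_1 psnd_pe)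

lemma Eval_cons:
  "Eval a n x \<Longrightarrow> Eval b n (list_encode l) \<Longrightarrow> Eval (ccons a b) n (list_encode (x # l))"
  unfolding ccons_def list_encode_Cons by (rule Eval_comp[OF Eval_pair]) (auto intro: Eval_S)

lemma Eval_ID: "Eval cID n n"
  unfolding cID_def by (rule Eval_comp[OF Eval_S]) (metis Eval_P diff_Suc_1)

definition citer :: "nat \<Rightarrow> nat" where "citer i = ((\<lambda>c. ccomp cTL c) ^^ i) cID"

lemma Eval_iter: "i \<le> length xs \<Longrightarrow> Eval (citer i) (list_encode xs) (list_encode (drop i xs))"
proof (induction i)
  case 0
  then show ?case by (simp add: citer_def Eval_ID)
next
  case (Suc i)
  then have IH: "Eval (citer i) (list_encode xs) (list_encode (drop i xs))" by simp
  from Suc.prems obtain y ys where "drop i xs = y # ys" "drop (Suc i) xs = ys"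
    by (metis Cons_nth_drop_Suc Suc_le_eq)
  then have "Eval cTL (list_encode (drop i xs)) (list_encode (drop (Suc i) xs))"
    using Eval_TL by metis
  from Eval_comp[OF IH this] show ?case unfolding citer_def by simp
qed

definition cproj :: "nat \<Rightarrow> nat" where "cproj i = ccomp cHD (citer i)"

lemma Eval_proj: "i < length xs \<Longrightarrow> Eval (cproj i) (list_encode xs) (xs ! i)"
  unfolding cproj_def
  by (rule Eval_comp[OF Eval_iter]) (simp, metis Cons_nth_drop_Suc Eval_HD)

fun clist :: "nat list \<Rightarrow> nat" where
  "clist [] = cZ"
| "clist (c # cs) = ccons c (clist cs)"

lemma Eval_clist:
  "\<forall>f\<in>set fs. Eval (C f) n (f x) \<Longrightarrow> Eval (clist (map C fs)) n (list_encode (map (\<lambda>f. f x) fs))"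
  by (induction fs) (auto intro!: Eval_cons simp: Eval_Z simp del: list_encode.simps(2))

definition computes :: "nat \<Rightarrow> nat \<Rightarrow> (nat list \<Rightarrow> nat) \<Rightarrow> bool" where
  "computes c n g \<longleftrightarrow> (\<forall>xs. length xs = n \<longrightarrow> Eval c (list_encode xs) (g xs))"

lemma computes_comp:
  assumes cg: "computes cg m g" and len: "length fs = m" and fs: "\<forall>f\<in>set fs. \<exists>c. computes c n f"
  shows "\<exists>c. computes c n (\<lambda>xs. g (map (\<lambda>f. f xs) fs))"
proof -
  from fs obtain C where C: "\<forall>f\<in>set fs. computes (C f) n f" by metis
  have "Eval (ccomp cg (clist (map C fs))) (list_encode xs) (g (map (\<lambda>f. f xs) fs))"
    if l: "length xs = n" for xs
  proof (rule Eval_comp)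
    show "Eval (clist (map C fs)) (list_encode xs) (list_encode (map (\<lambda>f. f xs) fs))"
      by (rule Eval_clist) (use C l in \<open>auto simp: computes_def\<close>)
    show "Eval cg (list_encode (map (\<lambda>f. f xs) fs)) (g (map (\<lambda>f. f xs) fs))"
      using cg len by (simp add: computes_def)
  qed
  then show ?thesis unfolding computes_def by blast
qed

lemma computes_prim:
  assumes cg: "computes cg n g" and ch: "computes ch (Suc (Suc n)) h"
  shows "\<exists>c. computes c (Suc n) (\<lambda>xs. rec_nat (g (tl xs)) (\<lambda>k r. h (k # r # tl xs)) (hd xs))"
proof -
  define ch' where "ch' = ccomp ch (ccons (ccomp cL cR) (ccons (ccomp cR cR) cL))"
  have step: "Eval ch' (pe (list_encode t) (pe k r)) (h (k # r # t))" if "length t = n" for t k r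
  proof -
    have "Eval (ccons (ccomp cL cR) (ccons (ccomp cR cR) cL)) (pe (list_encode t) (pe k r))
        (list_encode (k # r # t))"
      by (intro Eval_cons Eval_comp[OF Eval_R])
        (auto intro: Eval_L[of "pe k r", simplified] Eval_R[of "pe k r", simplified]
          Eval_L[of "pe (list_encode t) (pe k r)", simplified])
    moreover have "Eval ch (list_encode (k # r # t)) (h (k # r # t))"
      using ch that by (simp add: computes_def del: list_encode.simps)
    ultimately show ?thesis unfolding ch'_def by (rule Eval_comp)
  qed
  have rec: "Eval (cprec cg ch') (pe (list_encode t) k) (rec_nat (g t) (\<lambda>k r. h (k # r # t)) k)"
    if "length t = n" for t k
  proof (induction k)
    case 0
    show ?case unfolding cprec_def using cg that by (auto simp: computes_def intro: ev_prec0)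
  next
    case (Suc k)
    show ?case unfolding cprec_def
      by (simp, rule ev_precS[OF Suc[unfolded cprec_def] step[OF that]])
  qed
  have "Eval (ccomp (cprec cg ch') (cpair cTL cHD)) (list_encode xs)
      (rec_nat (g (tl xs)) (\<lambda>k r. h (k # r # tl xs)) (hd xs))" if "length xs = Suc n" for xs
  proof -
    from that obtain a t where xs: "xs = a # t" "length t = n" by (auto simp: length_Suc_conv)
    have "Eval (cpair cTL cHD) (list_encode xs) (pe (list_encode t) a)"
      unfolding xs by (intro Eval_pair Eval_TL Eval_HD)
    from Eval_comp[OF this rec[OF xs(2)]] show ?thesis using xs by simp
  qed
  then show ?thesis unfolding computes_def by blast
qed

lemma computes_mu:
  assumes cg: "computes cg (Suc n) g" and tot: "\<forall>xs. length xs = n \<longrightarrow> (\<exists>y. g (y # xs) = 0)"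
  shows "\<exists>c. computes c n (\<lambda>xs. LEAST y. g (y # xs) = 0)"
proof -
  define f' where "f' = ccomp cg (ccons cR cL)"
  have f': "Eval f' (pe (list_encode xs) y) (g (y # xs))" if "length xs = n" for xs y
  proof -
    have "Eval (ccons cR cL) (pe (list_encode xs) y) (list_encode (y # xs))"
      by (rule Eval_cons)
        (auto intro: Eval_L[of "pe (list_encode xs) y", simplified] Eval_R[of "pe (list_encode xs) y", simplified])
    moreover have "Eval cg (list_encode (y # xs)) (g (y # xs))"
      using cg that by (simp add: computes_def del: list_encode.simps)
    ultimately show ?thesis unfolding f'_def by (rule Eval_comp)
  qed
  have "Eval (cfind f') (list_encode xs) (LEAST y. g (y # xs) = 0)" if l: "length xs = n" for xs
  proof -
    obtain y0 where y0: "g (y0 # xs) = 0" using tot l by blast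
    let ?v = "LEAST y. g (y # xs) = 0"
    have v: "g (?v # xs) = 0" by (rule LeastI[of _ y0]) (rule y0)
    have "\<forall>y<?v. \<exists>w. w \<noteq> 0 \<and> Eval f' (pe (list_encode xs) y) w"
      using not_less_Least f'[OF l] by blast
    then show ?thesis unfolding cfind_def using f'[OF l, of ?v] v by (auto intro: ev_find)
  qed
  then show ?thesis unfolding computes_def by blast
qed

theorem recfn_has_program: "recfn n g \<Longrightarrow> \<exists>c. computes c n g"
proof (induction rule: recfn.induct)
  case (rf_zero n)
  show ?case unfolding computes_def by (rule exI[of _ cZ]) (simp add: Eval_Z)
next
  case rf_succ
  have "Eval (ccomp cS cHD) (list_encode xs) (Suc (hd xs))" if "length xs = 1" for xs
    using that by (auto intro!: Eval_comp[OF Eval_HD] Eval_S simp: length_Suc_conv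
        simp del: list_encode.simps)
  then show ?case unfolding computes_def by blast
next
  case (rf_proj i n)
  then show ?case unfolding computes_def by (auto intro!: exI[of _ "cproj i"] Eval_proj)
next
  case (rf_comp m g fs n)
  from rf_comp.IH(1) obtain cg where "computes cg m g" by blast
  moreover have "\<forall>f\<in>set fs. \<exists>c. computes c n f" using rf_comp.IH(2) by blast
  ultimately show ?case using rf_comp.hyps(2) by (intro computes_comp)
next
  case (rf_prim n g h)
  from rf_prim.IH obtain cg ch where "computes cg n g" "computes ch (Suc (Suc n)) h" by blast
  then show ?case by (rule computes_prim)
next
  case (rf_mu n g)
  from rf_mu.IH obtain cg where "computes cg (Suc n) g" by blast
  then show ?case using rf_mu.hyps(2) by (rule computes_mu)
qed

section \<open>Certificates of evaluations and the enumeration of c.e. sets\<close>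

text \<open>An evaluation fact \<open>Eval c n v\<close> is represented by the triple \<open>pe c (pe n v)\<close>, with
  components \<open>tc\<close>, \<open>tn\<close>, \<open>tv\<close>.\<close>

definition tc :: "nat \<Rightarrow> nat" where "tc t = pfst t"
definition tn :: "nat \<Rightarrow> nat" where "tn t = pfst (psnd t)"
definition tv :: "nat \<Rightarrow> nat" where "tv t = psnd (psnd t)"

lemma triple_simps [simp]: "tc (pe c (pe n v)) = c" "tn (pe c (pe n v)) = n" "tv (pe c (pe n v)) = v"
  by (simp_all add: tc_def tn_def tv_def)

text \<open>\<open>justified M t\<close>: the triple \<open>t\<close> follows by one rule of \<open>Eval\<close> from premises
  satisfying the quantifier \<open>M\<close>.  Instantiating \<open>M\<close> by "some earlier element of a
  list" gives both the set-based and the arithmetised (decidable) notion below.\<close>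

definition justified :: "((nat \<Rightarrow> bool) \<Rightarrow> bool) \<Rightarrow> nat \<Rightarrow> bool" where
  "justified M t \<longleftrightarrow>
    (if pfst (tc t) = 0 then tv t = 0 else
     if pfst (tc t) = 1 then tv t = Suc (tn t) else
     if pfst (tc t) = 2 then tv t = tn t - 1 else
     if pfst (tc t) = 3 then tv t = pfst (tn t) else
     if pfst (tc t) = 4 then tv t = psnd (tn t) else
     if pfst (tc t) = 5 then M (\<lambda>u. u = pe (pfst (psnd (tc t))) (pe (tn t) (pfst (tv t))))
        \<and> M (\<lambda>u. u = pe (psnd (psnd (tc t))) (pe (tn t) (psnd (tv t)))) else
     if pfst (tc t) = 6 then M (\<lambda>u. tc u = psnd (psnd (tc t)) \<and> tn u = tn t \<and>
        M (\<lambda>w. w = pe (pfst (psnd (tc t))) (pe (tv u) (tv t)))) else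
     if pfst (tc t) = 7 then
       (if psnd (tn t) = 0 then M (\<lambda>u. u = pe (pfst (psnd (tc t))) (pe (pfst (tn t)) (tv t)))
        else M (\<lambda>u. tc u = tc t \<and> tn u = pe (pfst (tn t)) (psnd (tn t) - 1) \<and>
        M (\<lambda>w. w = pe (psnd (psnd (tc t))) (pe (pe (pfst (tn t)) (pe (psnd (tn t) - 1) (tv u))) (tv t))))) else
     if pfst (tc t) = 8 then M (\<lambda>u. u = pe (psnd (tc t)) (pe (pe (tn t) (tv t)) 0)) \<and>
        (\<forall>y<tv t. M (\<lambda>u. tc u = psnd (tc t) \<and> tn u = pe (tn t) y \<and> tv u \<noteq> 0))
     else False)"

definition justified_by :: "nat set \<Rightarrow> nat \<Rightarrow> bool" where
  "justified_by E t = justified (\<lambda>P. \<exists>u\<in>E. P u) t"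

lemma justified_by_mono: "justified_by E t \<Longrightarrow> E \<subseteq> F \<Longrightarrow> justified_by F t"
  unfolding justified_by_def justified_def
  by (auto split: if_split_asm; meson subsetD)

lemma justified_sound:
  assumes sound: "\<And>u. u \<in> E \<Longrightarrow> Eval (tc u) (tn u) (tv u)" and just: "justified_by E t"
  shows "Eval (tc t) (tn t) (tv t)"
proof -
  have Eval_of_mem: "\<And>c n v. pe c (pe n v) \<in> E \<Longrightarrow> Eval c n v" using sound by fastforce
  obtain k p where kp: "tc t = pe k p" by (metis pe_split)
  note J = just[unfolded justified_by_def justified_def kp pfst_pe psnd_pe]
  consider "k \<le> 4" | "k = 5" | "k = 6" | "k = 7" | "k = 8" | "k > 8" by linarith
  then have "Eval (pe k p) (tn t) (tv t)"
  proof cases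
    assume "k \<le> 4"
    then have "k = 0 \<or> k = 1 \<or> k = 2 \<or> k = 3 \<or> k = 4" by linarith
    then show ?thesis using J by (auto intro: Eval.intros[unfolded One_nat_def])
  next
    assume k: "k = 5"
    then have "\<exists>u\<in>E. u = pe (pfst p) (pe (tn t) (pfst (tv t)))"
      "\<exists>u\<in>E. u = pe (psnd p) (pe (tn t) (psnd (tv t)))" using J by simp_all
    then have "Eval (pfst p) (tn t) (pfst (tv t))" "Eval (psnd p) (tn t) (psnd (tv t))"
      using Eval_of_mem by auto
    from ev_pair[OF this] k show ?thesis by simp
  next
    assume k: "k = 6"
    then have "\<exists>u\<in>E. tc u = psnd p \<and> tn u = tn t \<and>
        (\<exists>w\<in>E. w = pe (pfst p) (pe (tv u) (tv t)))" using J by simp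
    then obtain u where u: "u \<in> E" "tc u = psnd p" "tn u = tn t"
       "pe (pfst p) (pe (tv u) (tv t)) \<in> E" by auto
    from sound[OF u(1)] u(2,3) have "Eval (psnd p) (tn t) (tv u)" by simp
    from ev_comp[OF this Eval_of_mem[OF u(4)]] k show ?thesis by simp
  next
    assume k: "k = 7"
    show ?thesis
    proof (cases "psnd (tn t) = 0")
      case True
      then have "\<exists>u\<in>E. u = pe (pfst p) (pe (pfst (tn t)) (tv t))" using J k by simp
      then have "Eval (pfst p) (pfst (tn t)) (tv t)" using Eval_of_mem by auto
      from ev_prec0[OF this, of "psnd p"] True
      have "Eval (pe 7 p) (pe (pfst (tn t)) (psnd (tn t))) (tv t)" by simp
      then show ?thesis using k by simp
    next
      case False
      then have "\<exists>u\<in>E. tc u = pe k p \<and> tn u = pe (pfst (tn t)) (psnd (tn t) - 1) \<and>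
        (\<exists>w\<in>E. w = pe (psnd p) (pe (pe (pfst (tn t)) (pe (psnd (tn t) - 1) (tv u))) (tv t)))"
        using J k kp by simp
      then obtain u where u: "u \<in> E" "tc u = pe k p" "tn u = pe (pfst (tn t)) (psnd (tn t) - 1)"
        "pe (psnd p) (pe (pe (pfst (tn t)) (pe (psnd (tn t) - 1) (tv u))) (tv t)) \<in> E" by auto
      from sound[OF u(1)] u(2,3) k
      have "Eval (pe 7 (pe (pfst p) (psnd p))) (pe (pfst (tn t)) (psnd (tn t) - 1)) (tv u)" by simp
      from ev_precS[OF this Eval_of_mem[OF u(4)]] False show ?thesis using k by simp
    qed
  next
    assume k: "k = 8"
    then have a2: "\<exists>u\<in>E. u = pe p (pe (pe (tn t) (tv t)) 0)"
      and a3: "\<forall>y<tv t. \<exists>u\<in>E. tc u = p \<and> tn u = pe (tn t) y \<and> tv u \<noteq> 0" using J by simp_all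
    have "Eval p (pe (tn t) (tv t)) 0" using a2 Eval_of_mem by auto
    moreover have "\<forall>y<tv t. \<exists>w. w \<noteq> 0 \<and> Eval p (pe (tn t) y) w"
    proof (intro allI impI)
      fix y assume "y < tv t"
      with a3 obtain u where "u \<in> E" "tc u = p" "tn u = pe (tn t) y" "tv u \<noteq> 0" by blast
      with sound show "\<exists>w. w \<noteq> 0 \<and> Eval p (pe (tn t) y) w" by force
    qed
    ultimately have "Eval (pe 8 p) (tn t) (tv t)" by (rule ev_find)
    with k show ?thesis by simp
  next
    assume "k > 8" then show ?thesis using J by simp
  qed
  then show ?thesis using kp by simp
qed

definition valid_trace :: "nat list \<Rightarrow> bool" where
  "valid_trace xs \<longleftrightarrow> (\<forall>i<length xs. justified_by (set (take i xs)) (xs ! i))"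

lemma valid_trace_Nil: "valid_trace []" by (simp add: valid_trace_def)

lemma valid_trace_app: "valid_trace xs \<Longrightarrow> valid_trace ys \<Longrightarrow> valid_trace (xs @ ys)"
  unfolding valid_trace_def
proof (intro allI impI)
  fix i
  assume A: "\<forall>i<length xs. justified_by (set (take i xs)) (xs ! i)"
    and B: "\<forall>i<length ys. justified_by (set (take i ys)) (ys ! i)"
    and i: "i < length (xs @ ys)"
  show "justified_by (set (take i (xs @ ys))) ((xs @ ys) ! i)"
  proof (cases "i < length xs")
    case True
    then show ?thesis using A by (simp add: nth_append)
  next
    case False
    then have "justified_by (set (take (i - length xs) ys)) (ys ! (i - length xs))" using B i by simp
    then show ?thesis using False by (auto simp: nth_append elim!: justified_by_mono)
  qed
qed

lemma valid_trace_snoc: "valid_trace xs \<Longrightarrow> justified_by (set xs) t \<Longrightarrow> valid_trace (xs @ [t])"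
  unfolding valid_trace_def by (auto simp: nth_append less_Suc_eq)

lemma valid_trace_sound:
  assumes "valid_trace xs" and "pe c (pe n v) \<in> set xs"
  shows "Eval c n v"
proof -
  have "Eval (tc (xs!i)) (tn (xs!i)) (tv (xs!i))" if "i < length xs" for i
    using that
  proof (induction i rule: less_induct)
    case (less i)
    have "Eval (tc u) (tn u) (tv u)" if "u \<in> set (take i xs)" for u
    proof -
      from that obtain j where "j < i" "u = xs ! j" using less.prems by (auto simp: in_set_conv_nth)
      then show ?thesis using less by auto
    qed
    moreover have "justified_by (set (take i xs)) (xs ! i)"
      using assms(1) less.prems unfolding valid_trace_def by auto
    ultimately show ?case by (rule justified_sound)
  qed
  with assms(2) show ?thesis by (metis in_set_conv_nth triple_simps)
qed

lemma valid_trace_many: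
  "(\<forall>y<(v::nat). \<exists>xs. valid_trace xs \<and> T y \<in> set xs) \<Longrightarrow> \<exists>xs. valid_trace xs \<and> (\<forall>y<v. T y \<in> set xs)"
proof (induction v)
  case 0
  then show ?case using valid_trace_Nil by auto
next
  case (Suc v)
  then obtain xs where xs: "valid_trace xs" "\<forall>y<v. T y \<in> set xs" by auto
  from Suc.prems obtain ys where ys: "valid_trace ys" "T v \<in> set ys" by auto
  show ?case
    using valid_trace_app[OF xs(1) ys(1)] xs ys by (auto intro!: exI[of _ "xs @ ys"] simp: less_Suc_eq)
qed

lemma valid_trace_extend:
  "valid_trace L \<Longrightarrow> justified_by (set L) t \<Longrightarrow> \<exists>xs. valid_trace xs \<and> t \<in> set xs"
  by (metis valid_trace_snoc in_set_conv_decomp)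

lemma valid_trace_complete: "Eval c n v \<Longrightarrow> \<exists>xs. valid_trace xs \<and> pe c (pe n v) \<in> set xs"
proof (induction rule: Eval.induct)
  case (ev_pair f n a g b)
  from ev_pair.IH obtain xs ys where
    V1: "valid_trace xs" "pe f (pe n a) \<in> set xs" and V2: "valid_trace ys" "pe g (pe n b) \<in> set ys"
    by blast
  then show ?case
    by (intro valid_trace_extend[OF valid_trace_app[OF V1(1) V2(1)]])
      (auto simp: justified_by_def justified_def)
next
  case (ev_comp g n a f b)
  from ev_comp.IH obtain xs ys where
    V1: "valid_trace xs" "pe g (pe n a) \<in> set xs" and V2: "valid_trace ys" "pe f (pe a b) \<in> set ys"
    by blast
  then show ?case
    by (intro valid_trace_extend[OF valid_trace_app[OF V1(1) V2(1)]])
      (auto simp: justified_by_def justified_def intro!: bexI[of _ "pe g (pe n a)"])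
next
  case (ev_prec0 f a v g)
  from ev_prec0.IH obtain xs where "valid_trace xs" "pe f (pe a v) \<in> set xs" by blast
  then show ?case
    by (intro valid_trace_extend) (auto simp: justified_by_def justified_def)
next
  case (ev_precS f g a k r v)
  from ev_precS.IH obtain xs ys where
    V1: "valid_trace xs" "pe (pe 7 (pe f g)) (pe (pe a k) r) \<in> set xs" and
    V2: "valid_trace ys" "pe g (pe (pe a (pe k r)) v) \<in> set ys"
    by blast
  then show ?case
    by (intro valid_trace_extend[OF valid_trace_app[OF V1(1) V2(1)]])
      (auto simp: justified_by_def justified_def intro!: bexI[of _ "pe (pe 7 (pe f g)) (pe (pe a k) r)"])
next
  case (ev_find f n v)
  from ev_find.IH(1) obtain xs where xs: "valid_trace xs" "pe f (pe (pe n v) 0) \<in> set xs" by blast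
  from ev_find.IH(2)
  have "\<forall>y<v. \<exists>w. w \<noteq> 0 \<and> (\<exists>xs. valid_trace xs \<and> pe f (pe (pe n y) w) \<in> set xs)" by blast
  then obtain W where
    W: "\<forall>y<v. W y \<noteq> 0 \<and> (\<exists>xs. valid_trace xs \<and> pe f (pe (pe n y) (W y)) \<in> set xs)"
    by metis
  then obtain ys where ys: "valid_trace ys" "\<forall>y<v. pe f (pe (pe n y) (W y)) \<in> set ys"
    using valid_trace_many[of v "\<lambda>y. pe f (pe (pe n y) (W y))"] by auto
  have "justified_by (set (xs @ ys)) (pe (pe 8 f) (pe n v))"
    unfolding justified_by_def justified_def
  proof (simp, intro conjI allI impI)
    show "pe f (pe (pe n v) 0) \<in> set xs \<or> pe f (pe (pe n v) 0) \<in> set ys" using xs by simp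
  next
    fix y assume "y < v"
    then show "\<exists>u\<in>set xs \<union> set ys. tc u = f \<and> tn u = pe n y \<and> 0 < tv u"
      using ys W by (intro bexI[of _ "pe f (pe (pe n y) (W y))"]) auto
  qed
  then show ?case by (rule valid_trace_extend[OF valid_trace_app[OF xs(1) ys(1)]])
qed (rule valid_trace_extend[OF valid_trace_Nil], simp add: justified_by_def justified_def)+

text \<open>Traces are coded by \<open>list_encode\<close>; the following functions read such codes without
  decoding them, using bounded loops only, so that validity becomes decidable.\<close>

definition tl_code :: "nat \<Rightarrow> nat" where
  "tl_code x = psnd (x - 1)"

definition nth_code :: "nat \<Rightarrow> nat \<Rightarrow> nat" where
  "nth_code L j = pfst ((tl_code ^^ j) L - 1)"

lemma tl_code_list_encode: "tl_code (list_encode ys) = list_encode (tl ys)"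
proof (cases ys)
  case Nil
  have "psnd 0 = 0" by (metis pe_ge2 le_zero_eq pe_split)
  then show ?thesis using Nil by (simp add: tl_code_def)
next
  case (Cons a l)
  then show ?thesis by (simp add: tl_code_def list_encode_Cons del: list_encode.simps)
qed

lemma tl_code_funpow: "(tl_code ^^ j) (list_encode xs) = list_encode (drop j xs)"
  by (induction j) (auto simp: tl_code_list_encode drop_Suc tl_drop)

lemma list_encode_eq_0_iff: "list_encode ys = 0 \<longleftrightarrow> ys = []"
  by (cases ys) auto

lemma nth_code_list_encode: "j < length xs \<Longrightarrow> nth_code (list_encode xs) j = xs ! j"
  unfolding nth_code_def tl_code_funpow by (metis Cons_nth_drop_Suc list_encode_Cons diff_Suc_1 pfst_pe)

lemma length_le_list_encode: "length xs \<le> list_encode xs"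
proof (induction xs)
  case (Cons a xs)
  have "list_encode xs \<le> pe a (list_encode xs)" by (rule pe_ge2)
  with Cons show ?case by (simp add: list_encode_Cons del: list_encode.simps)
qed simp

text \<open>Justification, validity and membership read off a code; all quantifiers are bounded
  by the code itself, as a list is never longer than its code.\<close>

definition justified_code :: "nat \<Rightarrow> nat \<Rightarrow> bool" where
  "justified_code L i = justified (\<lambda>P. \<exists>j<i. P (nth_code L j)) (nth_code L i)"
definition valid_code :: "nat \<Rightarrow> bool" where
  "valid_code L \<longleftrightarrow> (\<forall>i<L. (tl_code ^^ i) L \<noteq> 0 \<longrightarrow> justified_code L i)"
definition mem_code :: "nat \<Rightarrow> nat \<Rightarrow> bool" where
  "mem_code L t \<longleftrightarrow> (\<exists>j<L. (tl_code ^^ j) L \<noteq> 0 \<and> nth_code L j = t)"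

lemma tl_code_funpow_nonzero: "(tl_code ^^ j) (list_encode xs) \<noteq> 0 \<longleftrightarrow> j < length xs"
  by (simp add: tl_code_funpow list_encode_eq_0_iff not_le)

lemma bex_set_take_iff: "i \<le> length xs \<Longrightarrow> (\<exists>u\<in>set (take i xs). P u) \<longleftrightarrow> (\<exists>j<i. P (xs!j))"
proof
  assume "i \<le> length xs" "\<exists>u\<in>set (take i xs). P u"
  then obtain j where "j < length (take i xs)" "P (take i xs ! j)" by (auto simp: in_set_conv_nth)
  then show "\<exists>j<i. P (xs!j)" by auto
next
  assume "i \<le> length xs" "\<exists>j<i. P (xs!j)"
  then obtain j where j: "j < i" "P (xs!j)" by blast
  then have "take i xs ! j \<in> set (take i xs)" using \<open>i \<le> length xs\<close> by (intro nth_mem) simp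
  with j show "\<exists>u\<in>set (take i xs). P u" by auto
qed

lemma justified_code_list_encode:
  "i < length xs \<Longrightarrow> justified_code (list_encode xs) i = justified_by (set (take i xs)) (xs ! i)"
proof -
  assume i: "i < length xs"
  have M: "(\<lambda>P. \<exists>j<i. P (nth_code (list_encode xs) j)) = (\<lambda>P. \<exists>u\<in>set (take i xs). P u)"
  proof (rule ext)
    fix P
    have "(\<exists>j<i. P (nth_code (list_encode xs) j)) \<longleftrightarrow> (\<exists>j<i. P (xs!j))"
      using i nth_code_list_encode by (metis order.strict_trans)
    also have "\<dots> \<longleftrightarrow> (\<exists>u\<in>set (take i xs). P u)" using i by (simp add: bex_set_take_iff)
    finally show "(\<exists>j<i. P (nth_code (list_encode xs) j)) = (\<exists>u\<in>set (take i xs). P u)" .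
  qed
  show ?thesis unfolding justified_code_def justified_by_def M nth_code_list_encode[OF i] ..
qed

lemma valid_code_list_encode: "valid_code (list_encode xs) \<longleftrightarrow> valid_trace xs"
proof -
  have "valid_code (list_encode xs) \<longleftrightarrow>
      (\<forall>i<list_encode xs. i < length xs \<longrightarrow> justified_code (list_encode xs) i)"
    unfolding valid_code_def tl_code_funpow_nonzero ..
  also have "\<dots> \<longleftrightarrow> (\<forall>i<length xs. justified_code (list_encode xs) i)"
    using length_le_list_encode[of xs] by (meson order.strict_trans2)
  also have "\<dots> \<longleftrightarrow> valid_trace xs" unfolding valid_trace_def using justified_code_list_encode by blast
  finally show ?thesis .
qed

lemma mem_code_list_encode: "mem_code (list_encode xs) t \<longleftrightarrow> t \<in> set xs"
proof -
  have "mem_code (list_encode xs) t \<longleftrightarrow>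
      (\<exists>j<list_encode xs. j < length xs \<and> nth_code (list_encode xs) j = t)"
    unfolding mem_code_def tl_code_funpow_nonzero ..
  also have "\<dots> \<longleftrightarrow> (\<exists>j<length xs. xs ! j = t)"
    using length_le_list_encode[of xs] by (force simp: nth_code_list_encode)
  also have "\<dots> \<longleftrightarrow> t \<in> set xs" by (auto simp: in_set_conv_nth)
  finally show ?thesis .
qed

lemma Eval_iff_certificate: "Eval c n v \<longleftrightarrow> (\<exists>L. valid_code L \<and> mem_code L (pe c (pe n v)))"
proof
  assume "Eval c n v"
  then obtain xs where "valid_trace xs" "pe c (pe n v) \<in> set xs" using valid_trace_complete by blast
  then show "\<exists>L. valid_code L \<and> mem_code L (pe c (pe n v))"
    by (auto simp: valid_code_list_encode mem_code_list_encode intro!: exI[of _ "list_encode xs"])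
next
  assume "\<exists>L. valid_code L \<and> mem_code L (pe c (pe n v))"
  then obtain L where "valid_code L" "mem_code L (pe c (pe n v))" by blast
  then have "valid_code (list_encode (list_decode L))"
    "mem_code (list_encode (list_decode L)) (pe c (pe n v))" by simp_all
  then have "valid_trace (list_decode L)" "pe c (pe n v) \<in> set (list_decode L)"
    unfolding valid_code_list_encode mem_code_list_encode .
  then show "Eval c n v" by (rule valid_trace_sound)
qed

text \<open>A c.e. set is \<open>{x. \<exists>y. g [x, y] = 0}\<close> for a recursive \<open>g\<close> with program \<open>e\<close>.  A
  witness for \<open>x\<close> is a pair \<open>p = (y, L)\<close> where \<open>L\<close> codes a valid trace containing
  the evaluation of \<open>e\<close> on \<open>[x, y]\<close> with value \<open>0\<close>.  So every c.e. set is the domain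
  of a decidable relation that is uniform in the index \<open>e\<close>.\<close>

definition witness :: "nat \<Rightarrow> nat \<Rightarrow> nat \<Rightarrow> bool" where
  "witness e x p \<longleftrightarrow> valid_code (psnd p) \<and> mem_code (psnd p) (pe e (pe (list_encode [x, pfst p]) 0))"

theorem ce_enumeration: "ce S \<Longrightarrow> \<exists>e. S = {x. \<exists>p. witness e x p}"
proof -
  assume "ce S"
  then obtain g where g: "recfn 2 g" "S = {x. \<exists>y. g [x, y] = 0}" unfolding ce_def by blast
  from recfn_has_program[OF g(1)] obtain c where c: "computes c 2 g" by blast
  have zero_iff: "g [x, y] = 0 \<longleftrightarrow> (\<exists>L. valid_code L \<and> mem_code L (pe c (pe (list_encode [x, y]) 0)))"
    for x y
  proof -
    have E: "Eval c (list_encode [x, y]) (g [x, y])"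
      using c unfolding computes_def by (metis length_Cons list.size(3) numeral_2_eq_2 One_nat_def)
    then have "g [x, y] = 0 \<longleftrightarrow> Eval c (list_encode [x, y]) 0" by (metis Eval_deterministic)
    then show ?thesis unfolding Eval_iff_certificate .
  qed
  have "(\<exists>y. g [x, y] = 0) \<longleftrightarrow> (\<exists>p. witness c x p)" for x
    unfolding witness_def zero_iff by (metis pfst_pe psnd_pe)
  with g(2) show ?thesis by blast
qed

lemma computable_tl_code_funpow:
  "computable f \<Longrightarrow> computable g \<Longrightarrow> computable (\<lambda>x. (tl_code ^^ g x) (f x))"
proof -
  have "computable (\<lambda>x. psnd (x - 1))" by (intro computable_psnd computable_sub computable_id computable_const)
  then have "computable tl_code" unfolding tl_code_def[abs_def] .
  then show "computable f \<Longrightarrow> computable g \<Longrightarrow> computable (\<lambda>x. (tl_code ^^ g x) (f x))"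
    by (rule computable_funpow)
qed

lemma computable_nth_code: "computable f \<Longrightarrow> computable g \<Longrightarrow> computable (\<lambda>x. nth_code (f x) (g x))"
  unfolding nth_code_def by (intro computable_pfst computable_sub computable_tl_code_funpow computable_const)

lemma computable_tc: "computable f \<Longrightarrow> computable (\<lambda>x. tc (f x))"
  unfolding tc_def by (rule computable_pfst)

lemma computable_tn: "computable f \<Longrightarrow> computable (\<lambda>x. tn (f x))"
  unfolding tn_def by (intro computable_pfst computable_psnd)

lemma computable_tv: "computable f \<Longrightarrow> computable (\<lambda>x. tv (f x))"
  unfolding tv_def by (intro computable_pfst computable_psnd)

lemmas computable_code_rules = computable_tl_code_funpow computable_nth_code
  computable_tc computable_tn computable_tv

lemma decidable_justified_code:
  assumes L: "computable L" and I: "computable I"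
  shows "decidable (\<lambda>x. justified_code (L x) (I x))"
  unfolding justified_code_def justified_def
  by (intro decidable_rules computable_rules computable_code_rules computable_comp[OF L] computable_comp[OF I])

lemma decidable_witness:
  assumes e: "computable e" and x: "computable x" and p: "computable p"
  shows "decidable (\<lambda>z. witness (e z) (x z) (p z))"
  unfolding witness_def valid_code_def mem_code_def list_encode_Cons list_encode.simps(1)
  by (intro decidable_rules computable_rules computable_code_rules decidable_justified_code
      computable_comp[OF e] computable_comp[OF x] computable_comp[OF p])

section \<open>Finite sets as numbers\<close>

text \<open>Membership in a coded finite set reads a binary digit, which is computable; since
  all elements of \<open>set_decode n\<close> are below \<open>n\<close>, disjointness and inclusion of codes
  are decidable by bounded quantification.\<close>

lemma div2_as_least: "(LEAST q. Suc x - 2 * Suc q = 0) = x div 2"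
  by (rule Least_equality) auto

lemma computable_div2: "computable (\<lambda>x. x div 2)"
proof -
  have "computable (\<lambda>x. LEAST q. Suc x - 2 * Suc q = 0)"
  proof (rule computable_mu[where g="\<lambda>q x. Suc x - 2 * Suc q"])
    show "computable (\<lambda>z. Suc (psnd z) - 2 * Suc (pfst z))"
      by (intro computable_rules)
    show "\<forall>x. \<exists>q. Suc x - 2 * Suc q = 0"
    proof
      fix x show "\<exists>q. Suc x - 2 * Suc q = 0" by (rule exI[of _ x]) simp
    qed
  qed
  then show ?thesis by (simp only: div2_as_least)
qed

lemma rec_nat_parity: "rec_nat 0 (\<lambda>k r. 1 - r) (x::nat) = (if odd x then 1 else (0::nat))"
  by (induction x) auto

lemma decidable_odd: "computable f \<Longrightarrow> decidable (\<lambda>x. odd (f x))"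
proof -
  assume f: "computable f"
  have "computable (\<lambda>x. rec_nat 0 (\<lambda>k r. 1 - r) (f x))"
    by (intro computable_rec computable_rules f)
  then show ?thesis unfolding decidable_def rec_nat_parity .
qed

lemma div_pow2_funpow: "(n::nat) div 2 ^ i = ((\<lambda>m. m div 2) ^^ i) n"
  by (induction i) (auto simp: div_mult2_eq power_Suc2 simp del: power_Suc)

lemma decidable_mem: "computable f \<Longrightarrow> computable g \<Longrightarrow> decidable (\<lambda>x. f x \<in> set_decode (g x))"
proof -
  assume f: "computable f" and g: "computable g"
  have "decidable (\<lambda>x. odd (((\<lambda>m. m div 2) ^^ f x) (g x)))"
    by (intro decidable_odd computable_funpow[OF computable_div2] f g)
  then show ?thesis unfolding set_decode_def by (simp add: div_pow2_funpow)
qed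

lemma set_decode_less: "i \<in> set_decode n \<Longrightarrow> i < n"
proof -
  assume "i \<in> set_decode n"
  then have "odd (n div 2 ^ i)" by (simp add: set_decode_def)
  then have "n div 2 ^ i \<noteq> 0" by (metis even_zero)
  then have "2 ^ i \<le> n" by (metis div_greater_zero_iff neq0_conv)
  then show ?thesis using less_exp[of i] by linarith
qed

definition disj_code :: "nat \<Rightarrow> nat \<Rightarrow> bool" where
  "disj_code a b \<longleftrightarrow> (\<forall>i<a. \<not> (i \<in> set_decode a \<and> i \<in> set_decode b))"

definition sub_code :: "nat \<Rightarrow> nat \<Rightarrow> bool" where
  "sub_code a b \<longleftrightarrow> (\<forall>i<a. i \<in> set_decode a \<longrightarrow> i \<in> set_decode b)"

lemma disj_code_iff: "disj_code a b \<longleftrightarrow> set_decode a \<inter> set_decode b = {}"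
  unfolding disj_code_def using set_decode_less by blast

lemma sub_code_iff: "sub_code a b \<longleftrightarrow> set_decode a \<subseteq> set_decode b"
  unfolding sub_code_def using set_decode_less by blast

lemma decidable_disj_code: "computable f \<Longrightarrow> computable g \<Longrightarrow> decidable (\<lambda>x. disj_code (f x) (g x))"
proof -
  assume f: "computable f" and g: "computable g"
  show ?thesis unfolding disj_code_def
    by (intro decidable_rules computable_rules decidable_mem computable_comp[OF f] computable_comp[OF g])
qed

lemma decidable_sub_code: "computable f \<Longrightarrow> computable g \<Longrightarrow> decidable (\<lambda>x. sub_code (f x) (g x))"
proof -
  assume f: "computable f" and g: "computable g"
  show ?thesis unfolding sub_code_def
    by (intro decidable_rules computable_rules decidable_mem computable_comp[OF f] computable_comp[OF g])
qed

lemma set_encode_disjoint_Un: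
  "finite A \<Longrightarrow> finite B \<Longrightarrow> A \<inter> B = {} \<Longrightarrow> set_encode (A \<union> B) = set_encode A + set_encode B"
  unfolding set_encode_def by (rule sum.union_disjoint)

lemma set_decode_add:
  assumes "set_decode a \<inter> set_decode b = {}"
  shows "set_decode (a + b) = set_decode a \<union> set_decode b"
proof -
  have "set_encode (set_decode a \<union> set_decode b) = a + b"
    using set_encode_disjoint_Un[OF finite_set_decode finite_set_decode assms] by simp
  then show ?thesis by (metis finite_UnI finite_set_decode set_encode_inverse)
qed

lemma set_decode_eq_empty_iff: "set_decode a = {} \<longleftrightarrow> a = 0"
  by (metis set_decode_inverse set_decode_zero set_encode_empty)

section \<open>The colouring\<close>

text \<open>Stage-\<open>s\<close> approximations.  \<open>enumerated s e x\<close>: \<open>x\<close> has a witness for \<open>W\<^sub>e\<close> below \<open>s\<close>.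
  \<open>stage_pick s e h\<close>: the least nonzero \<open>x < s\<close> enumerated into \<open>W\<^sub>e\<close> by stage \<open>s\<close>
  whose set is disjoint from \<open>h\<close> (or \<open>0\<close>).  \<open>stage_hist s e\<close>: the union (as a sum of
  codes) of the picks of requirements \<open>0, \<dots>, e - 1\<close>, each avoiding its predecessors.\<close>

definition enumerated :: "nat \<Rightarrow> nat \<Rightarrow> nat \<Rightarrow> bool" where
  "enumerated s e x \<longleftrightarrow> (\<exists>p<s. witness e x p)"

definition stage_search :: "nat \<Rightarrow> nat \<Rightarrow> nat \<Rightarrow> nat" where
  "stage_search s e h = (LEAST x. x = s \<or> (x \<noteq> 0 \<and> disj_code x h \<and> enumerated s e x))"

definition stage_pick :: "nat \<Rightarrow> nat \<Rightarrow> nat \<Rightarrow> nat" where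
  "stage_pick s e h = (if stage_search s e h < s then stage_search s e h else 0)"

definition stage_hist :: "nat \<Rightarrow> nat \<Rightarrow> nat" where
  "stage_hist s e = rec_nat 0 (\<lambda>i r. r + stage_pick s i r) e"

definition stage_found :: "nat \<Rightarrow> nat \<Rightarrow> nat" where
  "stage_found s e = stage_pick s e (stage_hist s e)"

text \<open>The least acting requirement \<open>e < z\<close> makes the colour of \<open>z\<close>
  differ from that of \<open>z\<close> minus the pick; \<open>C\<close> codes the set of smaller numbers of
  colour 1, so the colouring is defined by course-of-values recursion.\<close>

definition acts :: "nat \<Rightarrow> nat \<Rightarrow> bool" where
  "acts z e \<longleftrightarrow> stage_found z e \<noteq> 0 \<and> sub_code (stage_found z e) z \<and> stage_found z e \<noteq> z"

definition colour_step :: "nat \<Rightarrow> nat \<Rightarrow> nat" where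
  "colour_step z C = (if \<exists>e<z. acts z e
     then (if z - stage_found z (LEAST e. e = z \<or> acts z e) \<in> set_decode C then 0 else 1)
     else 0)"

definition colour_hist :: "nat \<Rightarrow> nat" where
  "colour_hist z = rec_nat 0 (\<lambda>i C. C + colour_step i C * 2 ^ i) z"

definition colouring :: "nat \<Rightarrow> nat" where
  "colouring z = colour_step z (colour_hist z)"

lemma decidable_enumerated:
  assumes a: "computable a" and b: "computable b" and c: "computable c"
  shows "decidable (\<lambda>x. enumerated (a x) (b x) (c x))"
  unfolding enumerated_def
  by (intro decidable_rules computable_rules decidable_witness
      computable_comp[OF a] computable_comp[OF b] computable_comp[OF c])

lemma computable_stage_pick:
  assumes a: "computable a" and b: "computable b" and c: "computable c"
  shows "computable (\<lambda>x. stage_pick (a x) (b x) (c x))"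
  unfolding stage_pick_def stage_search_def
  by (intro decidable_rules computable_rules decidable_enumerated decidable_disj_code
      computable_comp[OF a] computable_comp[OF b] computable_comp[OF c])

lemma computable_stage_found:
  assumes a: "computable a" and b: "computable b"
  shows "computable (\<lambda>x. stage_found (a x) (b x))"
  unfolding stage_found_def stage_hist_def
  by (intro computable_stage_pick computable_rec computable_rules computable_comp[OF a] computable_comp[OF b])

lemma decidable_acts:
  assumes a: "computable a" and b: "computable b"
  shows "decidable (\<lambda>x. acts (a x) (b x))"
  unfolding acts_def
  by (intro decidable_rules computable_rules decidable_sub_code computable_stage_found
      computable_comp[OF a] computable_comp[OF b])

lemma computable_colour_step:
  assumes a: "computable a" and b: "computable b"
  shows "computable (\<lambda>x. colour_step (a x) (b x))"
  unfolding colour_step_def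
  by (intro decidable_rules computable_rules decidable_acts decidable_mem computable_stage_found
      computable_comp[OF a] computable_comp[OF b])

theorem computable_colouring: "computable colouring"
  unfolding colouring_def colour_hist_def
  by (intro computable_colour_step computable_rec computable_rules)

lemma colouring_01: "colouring z = 0 \<or> colouring z = 1"
  unfolding colouring_def colour_step_def by auto

lemma colour_hist_eq: "colour_hist z = set_encode {w. w < z \<and> colouring w = 1}"
proof (induction z)
  case 0
  show ?case by (simp add: colour_hist_def)
next
  case (Suc z)
  have H: "colour_hist (Suc z) = colour_hist z + colouring z * 2 ^ z"
    by (simp add: colour_hist_def colouring_def)
  show ?case
  proof (cases "colouring z = 1")
    case True
    then have "{w. w < Suc z \<and> colouring w = 1} = insert z {w. w < z \<and> colouring w = 1}"
      by (auto simp: less_Suc_eq)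
    then show ?thesis using H Suc True by simp
  next
    case False
    then have "colouring z = 0" using colouring_01 by metis
    moreover have "{w. w < Suc z \<and> colouring w = 1} = {w. w < z \<and> colouring w = 1}"
      using False by (auto simp: less_Suc_eq)
    ultimately show ?thesis using H Suc by simp
  qed
qed

lemma colouring_diagonalises:
  assumes e: "e < z" "acts z e" and least: "\<forall>e'<e. \<not> acts z e'"
  shows "colouring z \<noteq> colouring (z - stage_found z e)"
proof -
  have "(LEAST e'. e' = z \<or> acts z e') = e"
    using e least by (intro Least_equality) (auto simp: not_less[symmetric])
  then have col: "colouring z = (if z - stage_found z e \<in> set_decode (colour_hist z) then 0 else 1)"
    unfolding colouring_def colour_step_def using e by auto
  have "stage_found z e \<noteq> 0" "stage_found z e \<le> z"
    using e(2) unfolding acts_def sub_code_iff by (auto intro: subset_decode_imp_le)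
  then have lt: "z - stage_found z e < z" by simp
  then have "z - stage_found z e \<in> set_decode (colour_hist z) \<longleftrightarrow> colouring (z - stage_found z e) = 1"
    unfolding colour_hist_eq by simp
  with col colouring_01[of "z - stage_found z e"] show ?thesis by auto
qed

text \<open>The limits of the stage approximations: \<open>pick e h\<close> is the least nonzero code in \<open>W\<^sub>e\<close>
  disjoint from \<open>h\<close> (or \<open>0\<close>), and \<open>hist e\<close> the code of \<open>F\<^sub>0 \<union> \<dots> \<union> F\<^sub>e\<^sub>-\<^sub>1\<close>.\<close>

definition candidate :: "nat \<Rightarrow> nat \<Rightarrow> nat \<Rightarrow> bool" where
  "candidate e h x \<longleftrightarrow> x \<noteq> 0 \<and> disj_code x h \<and> (\<exists>p. witness e x p)"

definition pick :: "nat \<Rightarrow> nat \<Rightarrow> nat" where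
  "pick e h = (if \<exists>x. candidate e h x then LEAST x. candidate e h x else 0)"

definition hist :: "nat \<Rightarrow> nat" where
  "hist e = rec_nat 0 (\<lambda>i r. r + pick i r) e"

lemma hist_0 [simp]: "hist 0 = 0"
  by (simp add: hist_def)

lemma hist_Suc: "hist (Suc e) = hist e + pick e (hist e)"
  by (simp add: hist_def)

lemma stage_hist_0 [simp]: "stage_hist s 0 = 0"
  by (simp add: stage_hist_def)

lemma stage_hist_Suc: "stage_hist s (Suc e) = stage_hist s e + stage_pick s e (stage_hist s e)"
  by (simp add: stage_hist_def)

lemma pick_candidate: "pick e h \<noteq> 0 \<Longrightarrow> candidate e h (pick e h)"
  unfolding pick_def by (metis (mono_tags, lifting) LeastI)

lemma pick_nonzero: "candidate e h x \<Longrightarrow> pick e h \<noteq> 0"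
  unfolding pick_def by (metis (mono_tags, lifting) LeastI candidate_def)

lemma stage_pick_candidate:
  assumes "stage_pick s e h \<noteq> 0"
  shows "candidate e h (stage_pick s e h)"
proof -
  have lt: "stage_search s e h < s" and eq: "stage_pick s e h = stage_search s e h"
    using assms by (auto simp: stage_pick_def split: if_splits)
  have "stage_search s e h = s \<or> (stage_search s e h \<noteq> 0 \<and> disj_code (stage_search s e h) h \<and>
      enumerated s e (stage_search s e h))"
    unfolding stage_search_def by (rule LeastI[of _ s]) simp
  with lt show ?thesis unfolding eq by (auto simp: candidate_def enumerated_def)
qed

lemma stage_pick_least_candidate:
  assumes x: "candidate e h x" and least: "\<And>y. candidate e h y \<Longrightarrow> x \<le> y"
    and p: "witness e x p" and s: "x < s" "p < s"
  shows "stage_pick s e h = x"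
proof -
  have "stage_search s e h = x" unfolding stage_search_def
  proof (rule Least_equality)
    show "x = s \<or> x \<noteq> 0 \<and> disj_code x h \<and> enumerated s e x"
      using x p s by (auto simp: candidate_def enumerated_def)
  next
    fix y assume "y = s \<or> y \<noteq> 0 \<and> disj_code y h \<and> enumerated s e y"
    then show "x \<le> y" using s least by (auto simp: candidate_def enumerated_def)
  qed
  with s show ?thesis by (simp add: stage_pick_def)
qed

lemma stage_pick_stabilises: "\<exists>s1. \<forall>s\<ge>s1. stage_pick s e h = pick e h"
proof (cases "\<exists>x. candidate e h x")
  case True
  let ?x = "LEAST x. candidate e h x"
  have x: "candidate e h ?x" using True by (metis LeastI)
  then obtain p where p: "witness e ?x p" by (auto simp: candidate_def)
  have "stage_pick s e h = ?x" if "s \<ge> max (Suc ?x) (Suc p)" for s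
    using that by (intro stage_pick_least_candidate[OF x Least_le p]) auto
  moreover have "pick e h = ?x" using True by (simp add: pick_def)
  ultimately show ?thesis by metis
next
  case False
  then have "stage_pick s e h = 0" for s using stage_pick_candidate by blast
  moreover have "pick e h = 0" using False by (simp add: pick_def)
  ultimately show ?thesis by simp
qed

text \<open>By induction on \<open>E\<close>: the history of \<open>e + 1\<close> only depends on the history and the pick
  of \<open>e\<close>, both of which have converged.\<close>

lemma stage_hist_stabilises: "\<exists>s0. \<forall>s\<ge>s0. \<forall>e\<le>E. stage_hist s e = hist e"
proof (induction E)
  case 0 show ?case by simp
next
  case (Suc E)
  then obtain s0 where s0: "\<forall>s\<ge>s0. \<forall>e\<le>E. stage_hist s e = hist e" by blast
  obtain s1 where s1: "\<forall>s\<ge>s1. stage_pick s E (hist E) = pick E (hist E)" using stage_pick_stabilises by blast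
  have "\<forall>s\<ge>max s0 s1. \<forall>e\<le>Suc E. stage_hist s e = hist e"
  proof (intro allI impI)
    fix s e assume s: "max s0 s1 \<le> s" and e: "e \<le> Suc E"
    show "stage_hist s e = hist e"
    proof (cases "e \<le> E")
      case True then show ?thesis using s0 s by simp
    next
      case False
      then have "e = Suc E" using e by simp
      then show ?thesis using s0 s1 s by (simp add: stage_hist_Suc hist_Suc)
    qed
  qed
  then show ?case by blast
qed

lemma stage_found_stabilises: "\<exists>s0. \<forall>s\<ge>s0. \<forall>e'\<le>e. stage_found s e' = pick e' (hist e')"
proof -
  obtain s0 where s0: "\<forall>s\<ge>s0. \<forall>e'\<le>Suc e. stage_hist s e' = hist e'" using stage_hist_stabilises by blast
  have "stage_found s e' = pick e' (hist e')" if "s \<ge> s0" "e' \<le> e" for s e'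
  proof -
    have "stage_hist s (Suc e') = hist (Suc e')" "stage_hist s e' = hist e'" using s0 that by auto
    then show ?thesis unfolding stage_found_def using stage_hist_Suc[of s e'] hist_Suc[of e'] by simp
  qed
  then show ?thesis by blast
qed

lemma set_decode_hist_Suc: "set_decode (hist (Suc e)) = set_decode (hist e) \<union> set_decode (pick e (hist e))"
proof (cases "pick e (hist e) = 0")
  case True then show ?thesis by (simp add: hist_Suc)
next
  case False
  then have "disj_code (pick e (hist e)) (hist e)" using pick_candidate by (simp add: candidate_def)
  then show ?thesis unfolding hist_Suc disj_code_iff by (subst set_decode_add) auto
qed

lemma pick_subset_hist: "e' < e \<Longrightarrow> set_decode (pick e' (hist e')) \<subseteq> set_decode (hist e)"
proof (induction e)
  case 0 then show ?case by simp
next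
  case (Suc e)
  then show ?case using set_decode_hist_Suc[of e] by (auto simp: less_Suc_eq)
qed

lemma hist_mono: "e' \<le> e \<Longrightarrow> set_decode (hist e') \<subseteq> set_decode (hist e)"
proof (induction e)
  case 0 then show ?case by simp
next
  case (Suc e)
  then show ?case using set_decode_hist_Suc[of e] by (auto simp: le_Suc_eq)
qed

section \<open>Meeting the requirements\<close>

lemma disjoint_family_avoids:
  assumes D: "infinite D" "pairwise disjnt D" and A: "finite A"
  shows "infinite {Y\<in>D. Y \<noteq> {} \<and> Y \<inter> A = {}}"
proof
  assume fin: "finite {Y\<in>D. Y \<noteq> {} \<and> Y \<inter> A = {}}"
  have one_member: "{Y\<in>D. a \<in> Y} \<subseteq> {SOME Y. Y \<in> D \<and> a \<in> Y}" for a
  proof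
    fix Y assume Y: "Y \<in> {Y\<in>D. a \<in> Y}"
    then have ex: "\<exists>Y. Y \<in> D \<and> a \<in> Y" by blast
    have "(SOME Y. Y \<in> D \<and> a \<in> Y) \<in> D \<and> a \<in> (SOME Y. Y \<in> D \<and> a \<in> Y)"
      by (rule someI_ex[OF ex])
    then show "Y \<in> {SOME Y. Y \<in> D \<and> a \<in> Y}"
      using Y D(2) unfolding pairwise_def disjnt_def by blast
  qed
  have "finite {Y\<in>D. a \<in> Y}" for a
    by (rule finite_subset[OF one_member]) simp
  then have "finite (\<Union>a\<in>A. {Y\<in>D. a \<in> Y})" using A by blast
  then have "finite ({Y\<in>D. Y \<noteq> {} \<and> Y \<inter> A = {}} \<union> (\<Union>a\<in>A. {Y\<in>D. a \<in> Y}) \<union> {{}})"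
    using fin by simp
  moreover have "D \<subseteq> {Y\<in>D. Y \<noteq> {} \<and> Y \<inter> A = {}} \<union> (\<Union>a\<in>A. {Y\<in>D. a \<in> Y}) \<union> {{}}"
    by blast
  ultimately have "finite D" by (rule finite_subset[rotated])
  with D(1) show False by simp
qed

lemma infinite_family_large_code:
  assumes "infinite T" "\<forall>Y\<in>T. finite Y"
  shows "\<exists>Y\<in>T. N \<le> set_encode Y"
proof (rule ccontr)
  assume "\<not> ?thesis"
  then have "\<forall>Y\<in>T. set_encode Y < N" by auto
  then have "T \<subseteq> set_decode ` {..<N}"
    using assms(2) by (auto intro!: image_eqI[of _ set_decode "set_encode _"])
  then have "finite T" by (rule finite_subset) simp
  with assms(1) show False by simp
qed

lemma pick_exists:
  assumes e: "S = {x. \<exists>p. witness e x p}"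
    and D: "infinite D" "D \<subseteq> set_decode ` S" "pairwise disjnt D"
  shows "pick e h \<noteq> 0"
proof -
  have "infinite {Y\<in>D. Y \<noteq> {} \<and> Y \<inter> set_decode h = {}}"
    by (rule disjoint_family_avoids[OF D(1,3) finite_set_decode])
  then have "{Y\<in>D. Y \<noteq> {} \<and> Y \<inter> set_decode h = {}} \<noteq> {}" by (rule infinite_imp_nonempty)
  then obtain Y where Y: "Y \<in> D" "Y \<noteq> {}" "Y \<inter> set_decode h = {}" by blast
  then obtain y where y: "y \<in> S" "Y = set_decode y" using D(2) by blast
  then have "candidate e h y"
    unfolding candidate_def disj_code_iff using e Y set_decode_eq_empty_iff by auto
  then show ?thesis by (rule pick_nonzero)
qed

text \<open>The heart of the argument: let \<open>F\<close> be the limit pick of requirement \<open>e\<close>.  For a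
  nonempty finite \<open>Y\<close> of large code avoiding the history \<open>H\<^sub>e\<^sub>+\<^sub>1\<close>, at stage \<open>z\<close>, the code of
  \<open>F \<union> Y\<close>, the approximations to requirements \<open>e' \<le> e\<close> are correct, requirement \<open>e\<close>
  acts (with pick \<open>F\<close>) and no smaller requirement does, since its pick lies in \<open>H\<^sub>e\<close>,
  which is disjoint from \<open>F \<union> Y\<close>.  Hence \<open>F \<union> Y\<close> and \<open>Y\<close> get different colours.\<close>

lemma requirement_met:
  assumes F: "pick e (hist e) \<noteq> 0"
  shows "\<exists>s0. \<forall>Y. finite Y \<and> Y \<noteq> {} \<and> Y \<inter> set_decode (hist (Suc e)) = {} \<and> s0 \<le> set_encode Y \<longrightarrow>
    colouring (set_encode (set_decode (pick e (hist e)) \<union> Y)) \<noteq> colouring (set_encode Y)"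
proof -
  define F where "F = pick e (hist e)"
  obtain s1 where s1: "\<forall>s\<ge>s1. \<forall>e'\<le>e. stage_found s e' = pick e' (hist e')"
    using stage_found_stabilises by blast
  have "colouring (set_encode (set_decode F \<union> Y)) \<noteq> colouring (set_encode Y)"
    if Y: "finite Y" "Y \<noteq> {}" "Y \<inter> set_decode (hist (Suc e)) = {}" and big: "s1 + Suc e \<le> set_encode Y"
    for Y
  proof -
    define z where "z = set_encode (set_decode F \<union> Y)"
    have "set_decode F \<inter> Y = {}" using Y(3) set_decode_hist_Suc[of e] F_def by auto
    then have z_sum: "z = F + set_encode Y"
      unfolding z_def using set_encode_disjoint_Un[OF finite_set_decode Y(1)] by simp
    have set_z: "set_decode z = set_decode F \<union> Y" unfolding z_def using Y(1) by simp
    have stable: "stage_found z e' = pick e' (hist e')" if "e' \<le> e" for e'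
      using s1 that big z_sum by auto
    have "set_encode Y \<noteq> 0" using Y(1,2) by (metis set_encode_inverse set_decode_zero)
    then have acts_e: "acts z e"
      unfolding acts_def sub_code_iff set_z stable[OF order_refl] F_def[symmetric]
      using F z_sum F_def by auto
    have no_smaller: "\<forall>e'<e. \<not> acts z e'"
    proof (intro allI impI notI)
      fix e' assume "e' < e" "acts z e'"
      then have ne: "set_decode (pick e' (hist e')) \<noteq> {}"
        and sub: "set_decode (pick e' (hist e')) \<subseteq> set_decode F \<union> Y"
        using stable[of e'] unfolding acts_def sub_code_iff set_z by (auto simp: set_decode_eq_empty_iff)
      have "set_decode (hist e) \<inter> set_decode F = {}"
        using pick_candidate[OF F] by (auto simp: candidate_def disj_code_iff F_def)
      moreover have "set_decode (hist e) \<inter> Y = {}" using Y(3) hist_mono[of e "Suc e"] by auto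
      ultimately show False using ne sub pick_subset_hist[OF \<open>e' < e\<close>] by blast
    qed
    have "e < z" using big z_sum by simp
    from colouring_diagonalises[OF this acts_e no_smaller]
    have "colouring z \<noteq> colouring (z - stage_found z e)" .
    moreover have "z - stage_found z e = set_encode Y" using stable[OF order_refl] z_sum F_def by simp
    ultimately show ?thesis unfolding z_def by simp
  qed
  then show ?thesis unfolding F_def by blast
qed

lemma NU_Un: "A \<in> T \<Longrightarrow> B \<in> T \<Longrightarrow> B \<noteq> {} \<Longrightarrow> A \<union> B \<in> NU T"
  unfolding NU_def by (intro CollectI conjI exI[of _ "{A, B}"]) auto

theorem colouring_not_constant:
  assumes S: "ce S" and D: "infinite D" "D \<subseteq> set_decode ` S" "pairwise disjnt D"
  shows "\<exists>A\<in>NU (set_decode ` S). \<exists>B\<in>NU (set_decode ` S). colouring (set_encode A) \<noteq> colouring (set_encode B)"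
proof -
  obtain e where e: "S = {x. \<exists>p. witness e x p}" using ce_enumeration[OF S] by blast
  let ?F = "pick e (hist e)"
  have F: "?F \<noteq> 0" by (rule pick_exists[OF e D])
  obtain s0 where s0: "\<forall>Y. finite Y \<and> Y \<noteq> {} \<and> Y \<inter> set_decode (hist (Suc e)) = {} \<and>
      s0 \<le> set_encode Y \<longrightarrow> colouring (set_encode (set_decode ?F \<union> Y)) \<noteq> colouring (set_encode Y)"
    using requirement_met[OF F] by blast
  let ?T = "{Y\<in>D. Y \<noteq> {} \<and> Y \<inter> set_decode (hist (Suc e)) = {}}"
  have "infinite ?T" by (rule disjoint_family_avoids[OF D(1,3) finite_set_decode])
  moreover have "\<forall>Y\<in>?T. finite Y" using D(2) by auto
  ultimately obtain Y where Y: "Y \<in> ?T" "s0 \<le> set_encode Y"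
    using infinite_family_large_code by blast
  have "finite Y" using Y(1) D(2) by auto
  with Y have differ: "colouring (set_encode (set_decode ?F \<union> Y)) \<noteq> colouring (set_encode Y)"
    using s0 by blast
  have "?F \<in> S" using pick_candidate[OF F] e by (auto simp: candidate_def)
  then have F_mem: "set_decode ?F \<in> set_decode ` S" by blast
  have Y_mem: "Y \<in> set_decode ` S" "Y \<noteq> {}" using Y(1) D(2) by auto
  have "set_decode ?F \<union> Y \<in> NU (set_decode ` S)" by (rule NU_Un[OF F_mem Y_mem])
  moreover have "Y \<in> NU (set_decode ` S)" using NU_Un[OF Y_mem(1) Y_mem] by simp
  ultimately show ?thesis using differ by blast
qed

theorem theorem3p1:
  shows "\<exists>c :: nat \<Rightarrow> nat. computable c \<and> (\<forall>x. c x \<in> {0, 1}) \<and>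
    (\<forall>S :: nat set. ce S \<and>
        (\<exists>D. infinite D \<and> D \<subseteq> set_decode ` S \<and> pairwise disjnt D) \<longrightarrow>
      (\<exists>A \<in> NU (set_decode ` S). \<exists>B \<in> NU (set_decode ` S).
          c (set_encode A) \<noteq> c (set_encode B)))"
proof (intro exI[of _ colouring] conjI allI impI)
  show "computable colouring" by (rule computable_colouring)
next
  fix x
  show "colouring x \<in> {0, 1}" using colouring_01[of x] by auto
next
  fix S :: "nat set"
  assume "ce S \<and> (\<exists>D. infinite D \<and> D \<subseteq> set_decode ` S \<and> pairwise disjnt D)"
  then show "\<exists>A \<in> NU (set_decode ` S). \<exists>B \<in> NU (set_decode ` S). colouring (set_encode A) \<noteq> colouring (set_encode B)"
    using colouring_not_constant by blast
qed

end
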